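(* Let $\Gamma$ be a finite, simple, strongly connected digraph of order $n\geq 4$ which is not an undirected graph. Then $\dim(\Gamma)=n-2$ if and only if $\Gamma$ is isomorphic to one of $G_2[K_1,P_2,K_1]$, $G_1[K_1,K_t,K_{n-t-1}]$, $G_2[K_1,K_t,K_{n-t-1}]$, $G_2[K_t,K_{n-t-1},K_1]$, or $G_2[K_1,\overline{K}_{n-2},K_1]$ for some integer $t$ with $1\leq t\leq n-2$.
   Context: All digraphs are finite, simple (no loops, at most one arc from $x$ to $y$ for each ordered pair) and strongly connected. $\partial(x,y)$ is the length of a shortest directed path from $x$ to $y$; $\tilde\partial(x,y)=(\partial(x,y),\partial(y,x))$. A subset $\{w_1,\dots,w_m\}$ of $V(\Gamma)$ is a weakly resolving set if $(\tilde\partial(w_1,u),\dots,\tilde\partial(w_m,u))\neq(\tilde\partial(w_1,v),\dots,\tilde\partial(w_m,v))$ for all distinct vertices $u,v$; $\dim(\Gamma)$ (weak metric dimension) is the minimum size of a weakly resolving set. A digraph is an undirected graph if for every arc $(x,y)$, $(y,x)$ is also an arc. $K_t$ is the complete digraph on $t$ vertices (all ordered pairs of distinct vertices are arcs), $\overline{K}_t$ the digraph on $t$ vertices with no arcs, and $P_2$ the digraph on two vertices $a,b$ with the single arc $(a,b)$. $G_1$ is the digraph on $\{0,1,2\}$ with arcs $(0,1),(1,2),(2,1),(2,0)$; $G_2$ is the digraph on $\{0,1,2\}$ with arcs $(0,1),(1,0),(1,2),(2,1),(2,0)$. For a digraph $G$ on $\{0,1,\dots,m-1\}$ and digraphs $H_0,\dots,H_{m-1}$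 with disjoint vertex sets, the generalized lexicographic product $G[H_0,\dots,H_{m-1}]$ has vertex set $V(H_0)\cup\dots\cup V(H_{m-1})$, and for $x\in V(H_i)$, $y\in V(H_j)$ there is an arc $(x,y)$ iff either $i=j$ and $(x,y)$ is an arc of $H_i$, or $i\neq j$ and $(i,j)$ is an arc of $G$. *)

theory Defs
  imports "Graph_Theory.Graph_Theory"
begin

text \<open>
  Distances are only meaningful when \<^term>\<open>v\<close> is reachable from \<^term>\<open>u\<close>; in a strongly
  connected digraph this holds for all pairs of vertices.
\<close>
definition digraph_dist :: "('a, 'b) pre_digraph \<Rightarrow> 'a \<Rightarrow> 'a \<Rightarrow> nat" where
  "digraph_dist G u v = (LEAST k. \<exists>p. pre_digraph.apath G u p v \<and> length p = k)"

definition two_way_dist :: "('a, 'b) pre_digraph \<Rightarrow> 'a \<Rightarrow> 'a \<Rightarrow> nat \<times> nat" where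
  "two_way_dist G u v = (digraph_dist G u v, digraph_dist G v u)"

definition weakly_resolving :: "('a, 'b) pre_digraph \<Rightarrow> 'a set \<Rightarrow> bool" where
  "weakly_resolving G W \<longleftrightarrow> finite W \<and> W \<subseteq> verts G \<and>
     (\<forall>u \<in> verts G. \<forall>v \<in> verts G. u \<noteq> v \<longrightarrow>
        (\<exists>w \<in> W. two_way_dist G w u \<noteq> two_way_dist G w v))"

definition weak_metric_dim :: "('a, 'b) pre_digraph \<Rightarrow> nat" where
  "weak_metric_dim G = (LEAST k. \<exists>W. weakly_resolving G W \<and> card W = k)"

definition K_digraph :: "nat \<Rightarrow> nat pair_pre_digraph" where
  "K_digraph t = \<lparr> pverts = {..<t}, parcs = {(x, y). x < t \<and> y < t \<and> x \<noteq> y} \<rparr>"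

definition arcless_digraph :: "nat \<Rightarrow> nat pair_pre_digraph" where
  "arcless_digraph t = \<lparr> pverts = {..<t}, parcs = {} \<rparr>"

definition P2_digraph :: "nat pair_pre_digraph" where
  "P2_digraph = \<lparr> pverts = {0, 1}, parcs = {(0, 1)} \<rparr>"

definition G1_digraph :: "nat pair_pre_digraph" where
  "G1_digraph = \<lparr> pverts = {0, 1, 2}, parcs = {(0, 1), (1, 2), (2, 1), (2, 0)} \<rparr>"

definition G2_digraph :: "nat pair_pre_digraph" where
  "G2_digraph = \<lparr> pverts = {0, 1, 2}, parcs = {(0, 1), (1, 0), (1, 2), (2, 1), (2, 0)} \<rparr>"

text \<open>
  The generalized lexicographic product \<open>G[H\<^sub>0, \<dots>, H\<^bsub>m-1\<^esub>]\<close>, for \<open>G\<close> a digraph on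
  \<open>{0, \<dots>, m-1}\<close> and \<open>Hs = [H\<^sub>0, \<dots>, H\<^bsub>m-1\<^esub>]\<close>. Tagging each vertex of \<open>H\<^sub>i\<close> with \<open>i\<close>
  makes the vertex sets of the factors disjoint.
\<close>
definition gen_lex_prod ::
    "nat pair_pre_digraph \<Rightarrow> 'a pair_pre_digraph list \<Rightarrow> (nat \<times> 'a) pair_pre_digraph" where
  "gen_lex_prod G Hs =
    \<lparr> pverts = (SIGMA i : {..<length Hs}. pverts (Hs ! i)),
      parcs = {((i, x), (j, y)) | i x j y.
        i < length Hs \<and> x \<in> pverts (Hs ! i) \<and> j < length Hs \<and> y \<in> pverts (Hs ! j) \<and>
        (i = j \<and> (x, y) \<in> parcs (Hs ! i) \<or> i \<noteq> j \<and> (i, j) \<in> parcs G)} \<rparr>"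

lemma complete_digraph_K_digraph: "complete_digraph t (with_proj (K_digraph t))"
proof -
  have "finite {(x, y). x < t \<and> y < t \<and> x \<noteq> y}"
    by (rule finite_subset[of _ "{..<t} \<times> {..<t}"]) auto
  then have "graph (with_proj (K_digraph t))"
    by unfold_locales
      (auto simp: K_digraph_def with_proj_def arc_to_ends_def symmetric_def arcs_ends_def sym_def)
  then show ?thesis
    by (auto simp: complete_digraph_def K_digraph_def)
qed

end

theory Submission
  imports Defs
begin

text \<open>
  A set of vertices resolves if and only if it separates the vertices outside it, so the dimension is
  \<open>n - 2\<close> exactly when no three vertices are pairwise separated by vertices outside the triple.
  The first three steps of a geodesic of length at least 3 form a triple separated by its initial
  vertex; hence distances are at most 2 and only adjacency matters. Moreover each vertex \<open>w\<close> sees at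
  most two of the types ``mutual arc'', ``outgoing single arc'', ``incoming single arc'', ``no arc''.

  If some vertex \<open>z\<close> has both an outgoing and an incoming single arc, all other pairs are mutual,
  which gives \<open>G\<^sub>1[K\<^sub>1, K\<^sub>t, K\<^bsub>n-t-1\<^esub>]\<close>. Otherwise let \<open>S\<close> and \<open>R\<close> be the sets of tails and heads of
  single arcs and \<open>C\<close> the rest: \<open>S\<close> and \<open>R\<close> are complete, and \<open>C\<close> is a symmetric graph joined
  mutually to everything else. Two disjoint single arcs force \<open>n = 4\<close> and \<open>G\<^sub>2[K\<^sub>1, P\<^sub>2, K\<^sub>1]\<close>. If there
  are none, then \<open>|R| = 1\<close> or \<open>|S| = 1\<close>, and either \<open>C\<close> is complete or \<open>|R| = |S| = 1\<close> and \<open>C\<close> has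
  no arcs.
\<close>

section \<open>Relations without a separated triple\<close>

text \<open>The function \<open>f\<close> is left open because the notion is needed twice: for
  \<open>two_way_dist\<close>, where it speaks about resolving sets, and for
  \<open>adj_type\<close>, where the classification takes place.\<close>

definition separated_triple :: "'a set \<Rightarrow> ('a \<Rightarrow> 'a \<Rightarrow> 'c) \<Rightarrow> bool" where
  "separated_triple V f \<longleftrightarrow> (\<exists>a\<in>V. \<exists>b\<in>V. \<exists>c\<in>V. a \<noteq> b \<and> b \<noteq> c \<and> a \<noteq> c \<and>
     (\<exists>w\<in>V - {a, b, c}. f w a \<noteq> f w b) \<and>
     (\<exists>w\<in>V - {a, b, c}. f w b \<noteq> f w c) \<and>
     (\<exists>w\<in>V - {a, b, c}. f w a \<noteq> f w c))"

text \<open>The witnesses lie outside the triple, so \<open>f\<close> and \<open>g\<close> need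
  comparing only where \<open>w\<close> differs from \<open>u\<close> and \<open>v\<close>. This
  matters: at \<open>w = u\<close> a distance is 0, while \<open>adj_type\<close> cannot tell
  \<open>u\<close> itself from a vertex not adjacent to \<open>u\<close>.\<close>

lemma separated_triple_mono:
  assumes "separated_triple V f"
    and "\<And>u v w. \<lbrakk>u \<in> V; v \<in> V; w \<in> V; w \<noteq> u; w \<noteq> v; f w u \<noteq> f w v\<rbrakk> \<Longrightarrow> g w u \<noteq> g w v"
  shows "separated_triple V g"
proof -
  obtain a b c where abc: "a \<in> V" "b \<in> V" "c \<in> V" "a \<noteq> b" "b \<noteq> c" "a \<noteq> c"
    and f: "\<exists>w\<in>V - {a, b, c}. f w a \<noteq> f w b" "\<exists>w\<in>V - {a, b, c}. f w b \<noteq> f w c"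
      "\<exists>w\<in>V - {a, b, c}. f w a \<noteq> f w c"
    using assms(1) unfolding separated_triple_def by blast
  have "\<exists>w\<in>V - {a, b, c}. g w a \<noteq> g w b" "\<exists>w\<in>V - {a, b, c}. g w b \<noteq> g w c"
    "\<exists>w\<in>V - {a, b, c}. g w a \<noteq> g w c"
    using f assms(2) abc(1-3) by blast+
  with abc show ?thesis unfolding separated_triple_def by blast
qed

section \<open>Adjacency types and block patterns\<close>

definition adj_type :: "('a \<Rightarrow> 'a \<Rightarrow> bool) \<Rightarrow> 'a \<Rightarrow> 'a \<Rightarrow> bool \<times> bool" where
  "adj_type E x y = (E x y, E y x)"

definition complete_on :: "('a \<Rightarrow> 'a \<Rightarrow> bool) \<Rightarrow> 'a set \<Rightarrow> bool" where
  "complete_on E A \<longleftrightarrow> (\<forall>x\<in>A. \<forall>y\<in>A. E x y \<longleftrightarrow> x \<noteq> y)"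

definition both_ways :: "('a \<Rightarrow> 'a \<Rightarrow> bool) \<Rightarrow> 'a set \<Rightarrow> 'a set \<Rightarrow> bool" where
  "both_ways E A B \<longleftrightarrow> (\<forall>x\<in>A. \<forall>y\<in>B. E x y \<and> E y x)"

definition one_way :: "('a \<Rightarrow> 'a \<Rightarrow> bool) \<Rightarrow> 'a set \<Rightarrow> 'a set \<Rightarrow> bool" where
  "one_way E A B \<longleftrightarrow> (\<forall>x\<in>A. \<forall>y\<in>B. E x y \<and> \<not> E y x)"

text \<open>Here and in \<open>G2_blocks\<close> the sets \<open>A\<close>, \<open>B\<close>,
  \<open>C\<close> stand at the vertices 0, 1, 2 of the quotient digraph.\<close>

definition G1_blocks :: "('a \<Rightarrow> 'a \<Rightarrow> bool) \<Rightarrow> 'a set \<Rightarrow> 'a set \<Rightarrow> 'a set \<Rightarrow> bool" where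
  "G1_blocks E A B C \<longleftrightarrow> one_way E A B \<and> both_ways E B C \<and> one_way E C A"

definition G2_blocks :: "('a \<Rightarrow> 'a \<Rightarrow> bool) \<Rightarrow> 'a set \<Rightarrow> 'a set \<Rightarrow> 'a set \<Rightarrow> bool" where
  "G2_blocks E A B C \<longleftrightarrow> both_ways E A B \<and> both_ways E B C \<and> one_way E C A"

definition tripartition :: "'a set \<Rightarrow> 'a set \<Rightarrow> 'a set \<Rightarrow> 'a set \<Rightarrow> bool" where
  "tripartition V A B C \<longleftrightarrow> V = A \<union> B \<union> C \<and> A \<inter> B = {} \<and> B \<inter> C = {} \<and> A \<inter> C = {} \<and>
     A \<noteq> {} \<and> B \<noteq> {} \<and> C \<noteq> {}"

definition mutual_arc :: "('a \<Rightarrow> 'a \<Rightarrow> bool) \<Rightarrow> 'a \<Rightarrow> 'a \<Rightarrow> bool" where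
  "mutual_arc E x y \<longleftrightarrow> E x y \<and> E y x"

definition single_arc :: "('a \<Rightarrow> 'a \<Rightarrow> bool) \<Rightarrow> 'a \<Rightarrow> 'a \<Rightarrow> bool" where
  "single_arc E x y \<longleftrightarrow> E x y \<and> \<not> E y x"

locale finite_relation =
  fixes V :: "'a set" and E :: "'a \<Rightarrow> 'a \<Rightarrow> bool"
  assumes finite_V: "finite V"
    and card_V: "4 \<le> card V"
    and E_in_V: "E x y \<Longrightarrow> x \<in> V \<and> y \<in> V"
    and E_irrefl: "\<not> E x x"

locale unseparated_relation = finite_relation +
  assumes diam_2: "\<lbrakk>x \<in> V; y \<in> V; x \<noteq> y; \<not> E x y\<rbrakk> \<Longrightarrow> \<exists>m. E x m \<and> E m y"
    and not_separated: "\<not> separated_triple V (adj_type E)"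
begin

text \<open>
  These two rules are stated for the fixed \<open>E\<close> only: with a schematic relation their left-hand
  sides match every relation and the simplifier loops.
\<close>

lemma mutual_arc_reversed [simp]: "mutual_arc (\<lambda>x y. E y x) = mutual_arc E"
  by (auto simp: mutual_arc_def fun_eq_iff)

lemma single_arc_reversed [simp]: "single_arc (\<lambda>x y. E y x) x y = single_arc E y x"
  by (auto simp: single_arc_def)

lemma single_arc_in_V: "single_arc E x y \<Longrightarrow> x \<in> V \<and> y \<in> V \<and> x \<noteq> y"
  using E_in_V[of x y] by (auto simp: single_arc_def)

text \<open>Reversal swaps the two components of \<open>adj_type\<close> and so keeps equality of
  types. Through this lemma every later statement about out-neighbours yields its dual about
  in-neighbours.\<close>

lemma reversed: "unseparated_relation V (\<lambda>x y. E y x)"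
proof
  have "adj_type (\<lambda>x y. E y x) w a = adj_type (\<lambda>x y. E y x) w b \<longleftrightarrow>
      adj_type E w a = adj_type E w b" for w a b
    by (auto simp: adj_type_def)
  then show "\<not> separated_triple V (adj_type (\<lambda>x y. E y x))"
    using not_separated unfolding separated_triple_def by (simp only: not_False_eq_True)
  show "\<exists>m. E m x \<and> E y m" if "x \<in> V" "y \<in> V" "x \<noteq> y" "\<not> E y x" for x y
    using diam_2[of y x] that by blast
  show "x \<in> V \<and> y \<in> V" if "E y x" for x y
    using E_in_V[OF that] by simp
qed (fact finite_V card_V E_irrefl)+

text \<open>The working form of \<open>not_separated\<close>: the witnesses \<open>u\<close>,
  \<open>v\<close>, \<open>w\<close> serve the pairs \<open>a b\<close>, \<open>b c\<close>,
  \<open>a c\<close> in this order, and may coincide.\<close>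

lemma separatedE:
  assumes "a \<in> V" "b \<in> V" "c \<in> V" "a \<noteq> b" "b \<noteq> c" "a \<noteq> c"
    and "u \<in> V" "u \<notin> {a, b, c}" "E u a \<noteq> E u b \<or> E a u \<noteq> E b u"
    and "v \<in> V" "v \<notin> {a, b, c}" "E v b \<noteq> E v c \<or> E b v \<noteq> E c v"
    and "w \<in> V" "w \<notin> {a, b, c}" "E w a \<noteq> E w c \<or> E a w \<noteq> E c w"
  shows False
proof -
  have "u \<in> V - {a, b, c}" "v \<in> V - {a, b, c}" "w \<in> V - {a, b, c}"
    using assms(7,8,10,11,13,14) by auto
  moreover have "adj_type E u a \<noteq> adj_type E u b" "adj_type E v b \<noteq> adj_type E v c"
    "adj_type E w a \<noteq> adj_type E w c"
    using assms(9,12,15) by (simp_all add: adj_type_def)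
  ultimately have "separated_triple V (adj_type E)"
    unfolding separated_triple_def
    using assms(1-6) by blast
  with not_separated show False ..
qed

lemma obtain_fourth:
  obtains w where "w \<in> V" "w \<notin> {x, y, z}"
proof -
  have "card {x, y, z} \<le> 3" by (simp add: card_insert_if)
  then have "\<not> V \<subseteq> {x, y, z}"
    using card_V card_mono[of "{x, y, z}" V] by auto
  then show thesis using that by auto
qed

lemma out_neighbour: assumes "x \<in> V" shows "\<exists>y. E x y"
proof -
  obtain y where "y \<in> V" "y \<noteq> x" using obtain_fourth[of x x x] by auto
  with diam_2[OF assms] show ?thesis by blast
qed

lemma in_neighbour: assumes "x \<in> V" shows "\<exists>y. E y x"
  by (rule unseparated_relation.out_neighbour[OF reversed assms])

text \<open>One vertex that sees three different types is the witness for all three pairs.\<close>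

lemma three_types:
  assumes "w \<in> V" "a \<in> V" "b \<in> V" "c \<in> V" "w \<notin> {a, b, c}"
    and "E w a \<noteq> E w b \<or> E a w \<noteq> E b w"
    and "E w b \<noteq> E w c \<or> E b w \<noteq> E c w"
    and "E w a \<noteq> E w c \<or> E a w \<noteq> E c w"
  shows False
proof -
  have "a \<noteq> b" "b \<noteq> c" "a \<noteq> c" using assms(6-8) by blast+
  then show False
    by (rule separatedE[OF assms(2-4) _ _ _ assms(1,5,6) assms(1,5,7) assms(1,5,8)])
qed

text \<open>Some in-neighbour \<open>u\<close> of \<open>x\<close> has type mutual or incoming. With
  the outgoing type of \<open>y\<close> and the empty type of \<open>z\<close> this would make three
  types at \<open>x\<close>.\<close>

lemma out_only_adjacent:
  assumes "single_arc E x y" "z \<in> V" "z \<noteq> x"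
  shows "E x z \<or> E z x"
proof (rule ccontr)
  assume N: "\<not> (E x z \<or> E z x)"
  obtain u where "E u x" using in_neighbour[of x] single_arc_in_V[OF assms(1)] by blast
  then have u: "E u x" "u \<in> V" "u \<noteq> x" using E_in_V E_irrefl by metis+
  show False
    by (rule three_types[of x y z u])
      (use u N assms single_arc_in_V[OF assms(1)] in \<open>auto simp: single_arc_def\<close>)
qed

lemma in_only_adjacent:
  assumes "single_arc E y x" "z \<in> V" "z \<noteq> x"
  shows "E x z \<or> E z x"
  using unseparated_relation.out_only_adjacent[OF reversed, of x y z] assms
  by auto

lemma not_out_in_both:
  assumes "single_arc E x y" "single_arc E z x" "mutual_arc E x u"
  shows False
proof -
  have u: "u \<in> V" "u \<noteq> x" using assms(3) E_in_V E_irrefl unfolding mutual_arc_def by metis+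
  show False
    by (rule three_types[of x y z u])
      (use u assms single_arc_in_V[OF assms(1)] single_arc_in_V[OF assms(2)]
        in \<open>auto simp: single_arc_def mutual_arc_def\<close>)
qed

subsection \<open>A vertex with an outgoing and an incoming single arc\<close>

text \<open>In the triple \<open>x\<close>, \<open>w\<close>, \<open>y\<close> the vertex
  \<open>z\<close> already separates \<open>y\<close> from the other two, so nothing outside the
  triple may separate \<open>x\<close> from \<open>w\<close>.\<close>

lemma out_neighbours_unseparated:
  assumes "single_arc E z x" "single_arc E z w" "single_arc E y z" "x \<noteq> w" "m \<in> V" "m \<notin> {x, w, y}"
  shows "E m x = E m w \<and> E x m = E w m"
proof (rule ccontr)
  assume "\<not> ?thesis"
  moreover have "x \<in> V" "w \<in> V" "y \<in> V" "z \<in> V" "z \<notin> {x, w, y}"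
    using assms by (auto dest: single_arc_in_V)
  ultimately show False
    by (intro separatedE[of x w y m z z]) (use assms in \<open>auto simp: single_arc_def\<close>)
qed

lemma in_neighbours_unseparated:
  assumes "single_arc E x z" "single_arc E w z" "single_arc E z y" "x \<noteq> w" "m \<in> V" "m \<notin> {x, w, y}"
  shows "E m x = E m w \<and> E x m = E w m"
  using unseparated_relation.out_neighbours_unseparated[OF reversed, of z x w y m] assms
  by simp

text \<open>The middle vertex of a path of length 2 from \<open>x\<close> back to \<open>z\<close>
  cannot be mutual with \<open>z\<close>, since \<open>z\<close> already sees the outgoing and the
  incoming type.\<close>

lemma out_neighbour_reaches:
  assumes "single_arc E z x" "single_arc E y z"
  obtains y' where "single_arc E y' z" "E x y'"
proof -
  obtain m where m: "E x m" "E m z"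
    using diam_2[of x z] assms single_arc_in_V[OF assms(1)] by (auto simp: single_arc_def)
  then have "\<not> E z m"
    using not_out_in_both[OF assms, of m] by (auto simp: mutual_arc_def)
  with m show thesis using that by (auto simp: single_arc_def)
qed

lemma in_neighbour_reached:
  assumes "single_arc E y z" "single_arc E z x"
  obtains x' where "single_arc E z x'" "E x' y"
  using unseparated_relation.out_neighbour_reaches[OF reversed, of z y x] assms by auto

text \<open>The vertex \<open>x\<close> has a single arc in and a single arc out, so it has no
  mutual arc and its arc with \<open>w\<close> is single. Both orientations \<open>p\<close>,
  \<open>q\<close> of that arc are refuted through a path of length 2 from \<open>q\<close> back to
  \<open>p\<close>, whose middle vertex turns out to be \<open>y\<close>.\<close>

lemma no_directed_triangle_aux:
  assumes "single_arc E z x" "single_arc E y z" "single_arc E x y" "single_arc E z w" "w \<noteq> x"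
  shows False
proof -
  have no_B: "\<not> mutual_arc E x u" for u
    using not_out_in_both[OF assms(3,1)] by blast
  have V: "x \<in> V" "y \<in> V" "z \<in> V" "w \<in> V" and ne: "y \<noteq> w"
    using assms by (auto dest: E_in_V simp: single_arc_def)
  have False if pq: "single_arc E p q" "{p, q} = {x, w}" for p q
  proof -
    have zpq: "single_arc E z p" "single_arc E z q" "p \<noteq> q" using pq assms by auto
    obtain m where m: "E q m" "E m p"
      using diam_2[of q p] pq(1) single_arc_in_V[OF pq(1)] by (auto simp: single_arc_def)
    have mV: "m \<in> V" "m \<noteq> p" "m \<noteq> q" "m \<noteq> z" 
      using m zpq E_in_V E_irrefl unfolding single_arc_def by metis+
    \<comment> \<open>Given an in-neighbour \<open>y'\<close> of \<open>z\<close> other than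
      \<open>m\<close>, the vertex \<open>m\<close> may not separate \<open>p\<close> from
      \<open>q\<close>. As \<open>E q m\<close> and \<open>E m p\<close>, both are then mutual with
      \<open>m\<close>, and one of them is \<open>x\<close>.\<close>
    have sole: "y' = m" if "single_arc E y' z" for y'
    proof (rule ccontr)
      assume "y' \<noteq> m"
      then have "E m p = E m q \<and> E p m = E q m"
        using out_neighbours_unseparated[OF zpq(1,2) that zpq(3)] mV by blast
      then have "mutual_arc E p m" "mutual_arc E q m" using m by (auto simp: mutual_arc_def)
      then show False using pq(2) no_B by (metis doubleton_eq_iff)
    qed
    then have "m = y" using assms by blast
    \<comment> \<open>The arc from \<open>x\<close> to \<open>y\<close> is single, so
      \<open>E m p\<close> with \<open>m = y\<close> excludes \<open>p = x\<close>.\<close>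
    then have "p = w" "q = x" using pq(2) m assms by (auto simp: single_arc_def doubleton_eq_iff)
    obtain y' where "single_arc E y' z" "E w y'" using out_neighbour_reaches[OF assms(4,2)] .
    then have "E w y" using sole \<open>m = y\<close> by blast
    then have "mutual_arc E y w" using m \<open>m = y\<close> \<open>p = w\<close> by (simp add: mutual_arc_def)
    then show False using not_out_in_both[OF assms(2,3)] by blast
  qed
  moreover have "E x w \<or> E w x" using in_only_adjacent[OF assms(1)] V assms(5) by blast
  ultimately show False using no_B[of w] unfolding mutual_arc_def single_arc_def by blast
qed

text \<open>A fourth vertex is a second single out-neighbour or in-neighbour of \<open>z\<close>.
  The second case is the first one for the reversed triangle.\<close>

lemma no_directed_triangle:
  assumes "single_arc E z x" "single_arc E y z" "single_arc E x y"
  shows False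
proof -
  obtain w where w: "w \<in> V" "w \<notin> {x, y, z}" by (rule obtain_fourth)
  have "E z w \<or> E w z" using out_only_adjacent[OF assms(1)] w by blast
  moreover have "\<not> mutual_arc E z w" using not_out_in_both[OF assms(1,2)] by blast
  ultimately consider "single_arc E z w" | "single_arc E w z"
    unfolding mutual_arc_def single_arc_def by blast
  then show False
  proof cases
    case 1
    then show ?thesis using no_directed_triangle_aux[OF assms 1] w by blast
  next
    case 2
    then show ?thesis
      using unseparated_relation.no_directed_triangle_aux[OF reversed, of z y x w] assms w by simp
  qed
qed

text \<open>A single arc from \<open>x\<close> to \<open>y\<close> would close a directed triangle.
  If the arc is single from \<open>y\<close> to \<open>x\<close>, then \<open>x\<close> reaches
  another in-neighbour \<open>y'\<close> of \<open>z\<close> but not \<open>y\<close>, and so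
  separates two in-neighbours of \<open>z\<close>.\<close>

lemma out_in_neighbours_mutual:
  assumes zx: "single_arc E z x" and yz: "single_arc E y z"
  shows "mutual_arc E x y"
proof (rule ccontr)
  assume n: "\<not> mutual_arc E x y"
  have V: "x \<in> V" "y \<in> V" "z \<in> V" and ne: "x \<noteq> y"
    using assms by (auto dest: E_in_V simp: single_arc_def)
  have "E x y \<or> E y x" using in_only_adjacent[OF zx V(2)] ne by blast
  then have yx: "E y x" "\<not> E x y"
    using n no_directed_triangle[OF assms] unfolding mutual_arc_def single_arc_def by blast+
  obtain y' where y': "single_arc E y' z" "E x y'" using out_neighbour_reaches[OF assms] .
  obtain x' where x': "single_arc E z x'" "E x' y" using in_neighbour_reached[OF yz zx] .
  have "y \<noteq> y'" "x \<noteq> x'" "x \<noteq> y'" using yx y' x' E_irrefl by metis+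
  then have "E x y = E x y'"
    using in_neighbours_unseparated[OF yz y'(1) x'(1), of x] V ne by blast
  then show False using yx y' by blast
qed

text \<open>A single arc between \<open>x\<close> and \<open>w\<close> would give its tail all three
  types: incoming from \<open>z\<close>, outgoing along that arc, and mutual with
  \<open>y\<close>.\<close>

lemma out_neighbours_mutual:
  assumes "single_arc E z x" "single_arc E y z" "single_arc E z w" "w \<noteq> x"
  shows "mutual_arc E x w"
proof -
  have "E x w \<or> E w x"
    using in_only_adjacent[OF assms(1), of w] assms(4) single_arc_in_V[OF assms(3)] by blast
  moreover have "\<not> single_arc E x w" "\<not> single_arc E w x"
    using not_out_in_both[OF _ assms(1) out_in_neighbours_mutual[OF assms(1,2)]]
      not_out_in_both[OF _ assms(3) out_in_neighbours_mutual[OF assms(3,2)]] by blast+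
  ultimately show ?thesis unfolding mutual_arc_def single_arc_def by blast
qed

lemma in_neighbours_mutual:
  assumes "single_arc E y z" "single_arc E z x" "single_arc E w z" "w \<noteq> y"
  shows "mutual_arc E y w"
  using unseparated_relation.out_neighbours_mutual[OF reversed, of z y x w] assms by simp

lemma G1_form:
  assumes zx: "single_arc E z x" and yz: "single_arc E y z"
  shows "\<exists>B C. tripartition V {z} B C \<and> G1_blocks E {z} B C \<and> complete_on E B \<and> complete_on E C"
proof -
  define B where "B = {u. single_arc E z u}"
  define C where "C = {u. single_arc E u z}"
  have "single_arc E z u \<or> single_arc E u z" if "u \<in> V" "u \<noteq> z" for u
    using out_only_adjacent[OF zx that] not_out_in_both[OF assms, of u]
    unfolding mutual_arc_def single_arc_def by blast
  then have "V = {z} \<union> B \<union> C"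
    using single_arc_in_V assms unfolding B_def C_def by blast
  moreover have "{z} \<inter> B = {}" "B \<inter> C = {}" "{z} \<inter> C = {}"
    by (auto simp: B_def C_def single_arc_def)
  moreover have "B \<noteq> {}" "C \<noteq> {}"
    using assms by (auto simp: B_def C_def)
  ultimately have "tripartition V {z} B C"
    unfolding tripartition_def by blast
  moreover have "both_ways E B C"
    unfolding both_ways_def
  proof (intro ballI)
    fix u v assume "u \<in> B" "v \<in> C"
    then have "mutual_arc E u v" using out_in_neighbours_mutual by (simp add: B_def C_def)
    then show "E u v \<and> E v u" by (simp add: mutual_arc_def)
  qed
  then have "G1_blocks E {z} B C"
    by (simp add: G1_blocks_def one_way_def B_def C_def single_arc_def)
  moreover have "complete_on E B"
    using out_neighbours_mutual[OF _ yz] E_irrefl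
    unfolding complete_on_def mutual_arc_def B_def by blast
  moreover have "complete_on E C"
    using in_neighbours_mutual[OF _ zx] E_irrefl
    unfolding complete_on_def mutual_arc_def C_def by blast
  ultimately show ?thesis by blast
qed

end

subsection \<open>No vertex has both an outgoing and an incoming single arc\<close>

locale split_relation = unseparated_relation +
  assumes split: "\<lbrakk>single_arc E x y; single_arc E y z\<rbrakk> \<Longrightarrow> False"
begin

definition "S = {x. \<exists>y. single_arc E x y}"
definition "R = {y. \<exists>x. single_arc E x y}"
definition "C = V - S - R"

lemma split_reversed: "split_relation V (\<lambda>x y. E y x)"
  by (intro split_relation.intro reversed split_relation_axioms.intro) (use split in auto)

lemma S_reversed: "split_relation.S (\<lambda>x y. E y x) = R"
  by (auto simp: split_relation.S_def[OF split_reversed] R_def)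

lemma R_reversed: "split_relation.R (\<lambda>x y. E y x) = S"
  by (auto simp: split_relation.R_def[OF split_reversed] S_def)

lemma C_reversed: "split_relation.C V (\<lambda>x y. E y x) = C"
  unfolding split_relation.C_def[OF split_reversed] C_def S_reversed R_reversed by blast

lemma S_D: "s \<in> S \<Longrightarrow> s \<in> V \<and> s \<notin> R \<and> s \<notin> C"
  and R_D: "r \<in> R \<Longrightarrow> r \<in> V \<and> r \<notin> S \<and> r \<notin> C"
  and C_D: "c \<in> C \<Longrightarrow> c \<in> V \<and> c \<notin> S \<and> c \<notin> R"
  using split single_arc_in_V unfolding S_def R_def C_def by blast+

lemma V_SRC: "V = S \<union> R \<union> C"
  by (auto simp: C_def dest: S_D R_D)

text \<open>A tail of a single arc is adjacent to every other vertex, and \<open>split\<close> rules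
  out single arcs into it.\<close>

lemma S_E: assumes "s \<in> S" "u \<in> V" "u \<noteq> s" shows "E s u"
proof -
  obtain y where y: "single_arc E s y" using assms(1) by (auto simp: S_def)
  have "E s u \<or> E u s" by (rule out_only_adjacent[OF y assms(2,3)])
  moreover have "\<not> single_arc E u s" using split y by blast
  ultimately show ?thesis by (auto simp: single_arc_def)
qed

lemma R_E: assumes "r \<in> R" "u \<in> V" "u \<noteq> r" shows "E u r"
  using split_relation.S_E[OF split_reversed, of r u] assms by (simp add: S_reversed)

lemma E_S_iff: assumes "s \<in> S" "u \<in> V" "u \<noteq> s" shows "E u s \<longleftrightarrow> \<not> single_arc E s u"
  using S_E[OF assms] by (auto simp: single_arc_def)

lemma single_arc_SR: "single_arc E x y \<Longrightarrow> x \<in> S \<and> y \<in> R"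
  by (auto simp: S_def R_def)

lemma nonR_E_S: assumes "s \<in> S" "u \<in> V - R" "u \<noteq> s" shows "E u s"
  using E_S_iff[of s u] single_arc_SR[of s u] assms by auto

lemma R_E_nonS: assumes "r \<in> R" "u \<in> V - S" "u \<noteq> r" shows "E r u"
  using split_relation.nonR_E_S[OF split_reversed, of r u] assms
  by (simp add: S_reversed R_reversed)

lemma C_sym: "\<lbrakk>c \<in> C; c' \<in> C\<rbrakk> \<Longrightarrow> E c c' = E c' c"
  using single_arc_SR[of c c'] single_arc_SR[of c' c] C_D by (auto simp: single_arc_def)

text \<open>After these facts only the arcs from \<open>R\<close> to \<open>S\<close> and those
  inside \<open>C\<close> remain open. The former amount to a bipartite graph between
  \<open>S\<close> and \<open>R\<close>, whose edges are the single arcs.\<close>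

lemma SRC_E:
  shows "\<lbrakk>s \<in> S; s' \<in> S; s \<noteq> s'\<rbrakk> \<Longrightarrow> E s s'" and "\<lbrakk>r \<in> R; r' \<in> R; r \<noteq> r'\<rbrakk> \<Longrightarrow> E r r'"
    and "\<lbrakk>s \<in> S; r \<in> R\<rbrakk> \<Longrightarrow> E s r"
    and "\<lbrakk>s \<in> S; c \<in> C\<rbrakk> \<Longrightarrow> E s c" and "\<lbrakk>s \<in> S; c \<in> C\<rbrakk> \<Longrightarrow> E c s"
    and "\<lbrakk>r \<in> R; c \<in> C\<rbrakk> \<Longrightarrow> E r c" and "\<lbrakk>r \<in> R; c \<in> C\<rbrakk> \<Longrightarrow> E c r"
  by (metis S_D R_D C_D S_E R_E nonR_E_S R_E_nonS DiffI)+

lemma exists_single_arc: "s \<in> S \<Longrightarrow> \<exists>r\<in>R. \<not> E r s" "r \<in> R \<Longrightarrow> \<exists>s\<in>S. \<not> E r s"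
  using single_arc_SR unfolding S_def R_def single_arc_def by blast+

section \<open>Two disjoint single arcs\<close>

text \<open>If \<open>r1\<close> or \<open>r2\<close> sends an arc to the tail of the other single
  arc, it separates \<open>s1\<close> from \<open>s2\<close>, and \<open>r1\<close>,
  \<open>r2\<close> separate these from \<open>c\<close>. Otherwise the triple \<open>s1\<close>,
  \<open>r1\<close>, \<open>c\<close> works: \<open>s2\<close> has a single arc to \<open>r1\<close>
  but is mutual with \<open>s1\<close> and \<open>c\<close>, and \<open>r2\<close> separates
  \<open>s1\<close> from \<open>c\<close>.\<close>

lemma no_centre:
  assumes s: "s1 \<in> S" "s2 \<in> S" "s1 \<noteq> s2" and r: "r1 \<in> R" "r2 \<in> R" "r1 \<noteq> r2"
    and nE: "\<not> E r1 s1" "\<not> E r2 s2" and c: "c \<in> C"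
  shows False
proof -
  have V: "s1 \<in> V" "s2 \<in> V" "r1 \<in> V" "r2 \<in> V" "c \<in> V"
    and ne: "s1 \<noteq> r1" "s1 \<noteq> r2" "s2 \<noteq> r1" "s2 \<noteq> r2" "c \<noteq> s1" "c \<noteq> s2" "c \<noteq> r1" "c \<noteq> r2"
    using s r c by (auto dest: S_D R_D C_D)
  note E = SRC_E(1)[OF s] SRC_E(2)[OF r] SRC_E(6,7)[OF r(1) c] SRC_E(6,7)[OF r(2) c]
    SRC_E(4,5)[OF s(1) c] SRC_E(4,5)[OF s(2) c]
  show False
  proof (cases "E r1 s2 \<or> E r2 s1")
    case True
    then have "E (if E r1 s2 then r1 else r2) s1 \<noteq> E (if E r1 s2 then r1 else r2) s2"
      using nE by auto
    then show False
      by (intro separatedE[of s1 s2 c "if E r1 s2 then r1 else r2" r2 r1])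
        (use V ne s(3) nE E in \<open>auto dest: S_D R_D C_D\<close>)
  next
    case False
    then show False
      by (intro separatedE[of s1 r1 c s2 s2 r2]) (use V ne s(3) r(3) nE E SRC_E(1)[of s2 s1] s r in \<open>auto dest: S_D R_D C_D\<close>)
  qed
qed

text \<open>In the bipartite graph of single arcs the vertices \<open>r1\<close>, \<open>s1\<close>,
  \<open>r2\<close>, \<open>s2\<close> would form an induced path. The middle vertex
  \<open>m\<close> of a path from \<open>r2\<close> to \<open>s1\<close> lies outside
  \<open>C\<close>, and together with \<open>s1\<close>, \<open>s2\<close> or with
  \<open>r1\<close>, \<open>r2\<close> it is a separated triple.\<close>

lemma no_path:
  assumes s: "s1 \<in> S" "s2 \<in> S" and r: "r1 \<in> R" "r2 \<in> R"
    and nE: "\<not> E r1 s1" "\<not> E r2 s2" "\<not> E r2 s1" and E: "E r1 s2"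
  shows False
proof -
  have ne: "s1 \<noteq> s2" "r1 \<noteq> r2" using nE E by auto
  have V: "s1 \<in> V" "s2 \<in> V" "r1 \<in> V" "r2 \<in> V" and ne': "r2 \<noteq> s1" using s r by (auto dest: S_D R_D C_D)
  obtain m where m: "E r2 m" "E m s1" using diam_2[of r2 s1] V ne' nE(3) by blast
  then have "m \<in> V" "m \<noteq> s1" "m \<noteq> r2" using E_in_V E_irrefl by metis+
  moreover have "m \<notin> C" using no_centre[OF s ne(1) r ne(2) nE(1,2)] by blast
  ultimately consider "m \<in> S" | "m \<in> R" using V_SRC by blast
  then show False
  proof cases
    case 1
    show False
      by (rule separatedE[of s1 s2 m r1 r2 r2]) (use 1 V s r ne m nE E in \<open>auto dest: S_D R_D C_D\<close>)
  next
    case 2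
    show False
      by (rule separatedE[of r1 r2 m s2 s1 s1]) (use 2 V s r ne m nE E in \<open>auto dest: S_D R_D C_D\<close>)
  qed
qed

text \<open>If the arc from \<open>w\<close> to \<open>r1\<close> were single, then \<open>w\<close>
  would separate \<open>r1\<close> from both \<open>s1\<close> and \<open>s2\<close>, which are
  separated from each other by \<open>r2\<close>.\<close>

lemma matching_third:
  assumes s: "s1 \<in> S" "s2 \<in> S" and r: "r1 \<in> R" "r2 \<in> R"
    and nE: "\<not> E r1 s1" "\<not> E r2 s2" and E: "E r2 s1" "E r1 s2"
    and w: "w \<in> S" "w \<noteq> s1" "w \<noteq> s2"
  shows "E r1 w"
proof (rule ccontr)
  assume "\<not> E r1 w"
  moreover have "s1 \<noteq> s2" "r1 \<noteq> r2" using nE E by auto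
  moreover have "E w s2" "E s2 w" "E w s1" "E s1 w" "E r2 r1" using SRC_E s r w \<open>r1 \<noteq> r2\<close> by blast+
  ultimately show False
    by (intro separatedE[of s2 r1 s1 w w r2]) (use s r w nE E SRC_E(3)[of s1 r2] in \<open>auto dest: S_D R_D C_D\<close>)
qed

text \<open>A third vertex \<open>w\<close> of \<open>S\<close> is mutual with both
  \<open>r1\<close> and \<open>r2\<close>, while \<open>s1\<close> and \<open>s2\<close> each lack
  the arc from one of them; so \<open>r1\<close>, \<open>r2\<close> separate \<open>s1\<close>,
  \<open>s2\<close>, \<open>w\<close>.\<close>

lemma matching_spans_S:
  assumes s: "s1 \<in> S" "s2 \<in> S" and r: "r1 \<in> R" "r2 \<in> R"
    and nE: "\<not> E r1 s1" "\<not> E r2 s2" and E: "E r2 s1" "E r1 s2"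
  shows "S = {s1, s2}"
proof (rule ccontr)
  assume "S \<noteq> {s1, s2}"
  then obtain w where w: "w \<in> S" "w \<noteq> s1" "w \<noteq> s2" using s by blast
  have "E r1 w" "E r2 w"
    using matching_third[OF s r nE E w]
      matching_third[OF s(2,1) r(2,1) nE(2,1) E(2,1) w(1,3,2)] by blast+
  moreover have "s1 \<noteq> s2" using nE E by auto
  ultimately show False
    by (intro separatedE[of s1 s2 w r1 r2 r1]) (use s r w nE E in \<open>auto dest: S_D R_D C_D\<close>)
qed

lemma matching_spans:
  assumes s: "s1 \<in> S" "s2 \<in> S" and r: "r1 \<in> R" "r2 \<in> R"
    and nE: "\<not> E r1 s1" "\<not> E r2 s2" and E: "E r2 s1" "E r1 s2"
  shows "S = {s1, s2} \<and> R = {r1, r2} \<and> C = {}"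
proof (intro conjI)
  have ne: "s1 \<noteq> s2" "r1 \<noteq> r2" using nE E by auto
  show "S = {s1, s2}" by (rule matching_spans_S[OF assms])
  show "R = {r1, r2}"
    using split_relation.matching_spans_S[OF split_reversed, of r1 r2 s1 s2] assms
    by (simp add: S_reversed R_reversed)
  show "C = {}" using no_centre[OF s ne(1) r ne(2) nE] by blast
qed

text \<open>If only one of the two arcs is missing, there is an induced path. If both are, the
  middle vertex \<open>m\<close> of a path from \<open>r1\<close> to \<open>s1\<close> is a new
  vertex of \<open>S\<close> or \<open>R\<close>. A single arc at \<open>m\<close> is disjoint from
  the one from \<open>s1\<close> to \<open>r1\<close> and forms with it either an induced path or a
  matching; the matching would leave no room for \<open>s2\<close> or \<open>r2\<close>.\<close>

lemma disjoint_single_arcs_mutual: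
  assumes s: "s1 \<in> S" "s2 \<in> S" "s1 \<noteq> s2" and r: "r1 \<in> R" "r2 \<in> R" "r1 \<noteq> r2"
    and nE: "\<not> E r1 s1" "\<not> E r2 s2"
  shows "E r1 s2 \<and> E r2 s1"
proof (rule ccontr)
  assume "\<not> ?thesis"
  then have nE': "\<not> E r1 s2" "\<not> E r2 s1"
    using no_path[OF s(1,2) r(1,2) nE] no_path[OF s(2,1) r(2,1) nE(2,1)] by blast+
  have V: "s1 \<in> V" "s2 \<in> V" "r1 \<in> V" "r2 \<in> V" and ne': "r1 \<noteq> s1" using s r by (auto dest: S_D R_D C_D)
  obtain m where m: "E r1 m" "E m s1" using diam_2[of r1 s1] V ne' nE(1) by blast
  then have "m \<in> V" "m \<noteq> s1" "m \<noteq> r1" "m \<noteq> s2" "m \<noteq> r2" using E_in_V E_irrefl nE' by metis+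
  moreover have "m \<notin> C" using no_centre[OF s r nE] by blast
  ultimately consider "m \<in> S" | "m \<in> R" using V_SRC by blast
  then show False
  proof cases
    case 1
    then obtain r3 where r3: "r3 \<in> R" "\<not> E r3 m" using exists_single_arc(1) by blast
    show False
    proof (cases "E r3 s1")
      case True
      then have "S = {s1, m}" using matching_spans[OF s(1) 1 r(1) r3(1) nE(1) r3(2)] m by blast
      then show False using s \<open>m \<noteq> s2\<close> by auto
    next
      case False
      then show False using no_path[OF s(1) 1 r(1) r3(1) nE(1) r3(2)] m by blast
    qed
  next
    case 2
    then obtain s3 where s3: "s3 \<in> S" "\<not> E m s3" using exists_single_arc(2) by blast
    show False
    proof (cases "E r1 s3")
      case True
      then have "R = {r1, m}" using matching_spans[OF s(1) s3(1) r(1) 2 nE(1) s3(2)] m by blast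
      then show False using r \<open>m \<noteq> r2\<close> by auto
    next
      case False
      then show False using no_path[OF s3(1) s(1) 2 r(1) s3(2) nE(1)] m by blast
    qed
  qed
qed

lemma P2_form:
  assumes s: "s1 \<in> S" "s2 \<in> S" "s1 \<noteq> s2" and r: "r1 \<in> R" "r2 \<in> R" "r1 \<noteq> r2"
    and nE: "\<not> E r1 s1" "\<not> E r2 s2"
  shows "tripartition V {r1} {s2, r2} {s1} \<and> G2_blocks E {r1} {s2, r2} {s1} \<and>
    E s2 r2 \<and> \<not> E r2 s2 \<and> s2 \<noteq> r2"
proof -
  have E: "E r2 s1" "E r1 s2" using disjoint_single_arcs_mutual[OF assms] by blast+
  then have *: "S = {s1, s2}" "R = {r1, r2}" "C = {}"
    using matching_spans[OF s(1,2) r(1,2) nE] by blast+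
  have ne: "s1 \<noteq> r1" "s1 \<noteq> r2" "s2 \<noteq> r1" "s2 \<noteq> r2" using s r by (auto dest: S_D R_D C_D)
  have V: "V = {s1, s2, r1, r2}" using V_SRC unfolding * by auto
  have "tripartition V {r1} {s2, r2} {s1}"
    unfolding tripartition_def V using ne s(3) r(3) by blast
  moreover have "G2_blocks E {r1} {s2, r2} {s1}"
    using SRC_E(1)[of s1 s2] SRC_E(1)[of s2 s1] SRC_E(2)[of r1 r2] SRC_E(2)[of r2 r1]
      SRC_E(3)[of s1 r1] SRC_E(3)[of s1 r2] SRC_E(3)[of s2 r1] s r E nE
    unfolding G2_blocks_def both_ways_def one_way_def by blast
  ultimately show ?thesis using SRC_E(3)[of s2 r2] s r nE ne by blast
qed

section \<open>A single head, and the choice between the cases\<close>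

text \<open>All single arcs run from \<open>S\<close> to \<open>r\<close>. The block
  \<open>C\<close> is nonempty because a path of length 2 from \<open>r\<close> to a tail must pass
  through it.\<close>

lemma one_sided_form:
  assumes R: "R = {r}"
  shows "tripartition V {r} C S \<and> G2_blocks E {r} C S \<and> complete_on E S \<and>
    (complete_on E C \<or> card S = 1 \<and> (\<forall>x\<in>C. \<forall>y\<in>C. \<not> E x y))"
proof (intro conjI)
  have rS: "\<not> E r s" if "s \<in> S" for s using exists_single_arc(1)[OF that] R by auto
  obtain s where s: "s \<in> S" using exists_single_arc(2)[of r] R by blast
  have r: "r \<in> R" using R by blast
  have "r \<noteq> s" "r \<in> V" "s \<in> V" using s r by (auto dest: S_D R_D C_D)
  then obtain m where m: "E r m" "E m s" using diam_2[of r s] rS[OF s] by blast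
  then have "m \<in> V" "m \<noteq> r" "m \<notin> S" using E_in_V E_irrefl rS by metis+
  then have "m \<in> C" using V_SRC R by blast
  then show "tripartition V {r} C S"
    unfolding tripartition_def using s R V_SRC by (auto dest: S_D R_D C_D)
  show "G2_blocks E {r} C S"
    unfolding G2_blocks_def both_ways_def one_way_def using SRC_E(3-7) rS r by blast
  show "complete_on E S"
    unfolding complete_on_def using SRC_E(1) E_irrefl by blast
  show "complete_on E C \<or> card S = 1 \<and> (\<forall>x\<in>C. \<forall>y\<in>C. \<not> E x y)"
  proof (rule disjCI)
    assume not: "\<not> (card S = 1 \<and> (\<forall>x\<in>C. \<forall>y\<in>C. \<not> E x y))"
    show "complete_on E C"
    proof (rule ccontr)
      assume "\<not> complete_on E C"
      then obtain a b where ab: "a \<in> C" "b \<in> C" "a \<noteq> b" "\<not> E a b"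
        unfolding complete_on_def using E_irrefl by blast
      then have "\<not> E b a" using C_sym by blast
      \<comment> \<open>A second tail \<open>s'\<close> would make \<open>a\<close>,
        \<open>s\<close>, \<open>r\<close> separated: \<open>b\<close> is mutual with
        \<open>s\<close> but not adjacent to \<open>a\<close>, and \<open>s'\<close> has a single
        arc to \<open>r\<close> only.\<close>
      have "S = {s}"
      proof (rule ccontr)
        assume "S \<noteq> {s}"
        then obtain s' where s': "s' \<in> S" "s' \<noteq> s" using s by blast
        note E = SRC_E(1)[OF s' (1) s s'(2)] SRC_E(1)[OF s s'(1) s'(2)[symmetric]]
          SRC_E(3)[OF s'(1) r] SRC_E(4,5)[OF s'(1) ab(1)] SRC_E(4,5)[OF s ab(2)]
          SRC_E(6,7)[OF r ab(2)] rS[OF s'(1)]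
        show False
          by (rule separatedE[of a s r b s' s']) (use s s' r ab E in \<open>auto dest: S_D R_D C_D\<close>)
      qed
      then have "card S = 1" by simp
      with not obtain u v where uv: "u \<in> C" "v \<in> C" "E u v" by blast
      \<comment> \<open>Since \<open>C\<close> is neither complete nor arcless, some
        \<open>c\<close> in \<open>C\<close> has both a non-neighbour \<open>p\<close> and a
        neighbour \<open>q\<close> there. Then \<open>c\<close> separates \<open>p\<close> from
        \<open>q\<close>, and \<open>r\<close> separates both from \<open>s\<close>.\<close>
      have "\<exists>c\<in>C. \<exists>p\<in>C. \<exists>q\<in>C. c \<noteq> p \<and> \<not> E c p \<and> E c q"
      proof (cases "E a u")
        case True
        then show ?thesis using ab uv by blast
      next
        case False
        then show ?thesis using ab uv C_sym E_irrefl by metis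
      qed
      then obtain c p q where cpq: "c \<in> C" "p \<in> C" "q \<in> C" "c \<noteq> p" "\<not> E c p" "E c q" by blast
      have "c \<noteq> q" "p \<noteq> q" using cpq E_irrefl by metis+
      note E = SRC_E(3)[OF s r] rS[OF s] SRC_E(6,7)[OF r cpq(2)] SRC_E(6,7)[OF r cpq(3)]
      show False
        by (rule separatedE[of p q s c r r])
          (use s r cpq \<open>c \<noteq> q\<close> \<open>p \<noteq> q\<close> E in \<open>auto dest: S_D R_D C_D\<close>)
    qed
  qed
qed

text \<open>A bipartite graph without isolated vertices that has at least two vertices on each side
  contains two disjoint edges.\<close>

lemma single_arcs_cases:
  assumes "single_arc E x y"
  obtains (left) r where "R = {r}" | (right) s where "S = {s}"
    | (disjoint) s1 s2 r1 r2 where "s1 \<in> S" "s2 \<in> S" "s1 \<noteq> s2" "r1 \<in> R" "r2 \<in> R" "r1 \<noteq> r2"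
      "\<not> E r1 s1" "\<not> E r2 s2"
proof -
  have xy: "x \<in> S" "y \<in> R" "\<not> E y x" using single_arc_SR[OF assms] assms by (auto simp: single_arc_def)
  show thesis
  proof (cases "S = {x} \<or> R = {y}")
    case True
    then show thesis using left right by blast
  next
    case False
    then obtain s r where s: "s \<in> S" "s \<noteq> x" and r: "r \<in> R" "r \<noteq> y" using xy by blast
    obtain r' where r': "r' \<in> R" "\<not> E r' s" using exists_single_arc(1)[OF s(1)] by blast
    obtain s' where s': "s' \<in> S" "\<not> E r s'" using exists_single_arc(2)[OF r(1)] by blast
    consider "r' \<noteq> y" | "s' \<noteq> x" | "r' = y" "s' = x" by blast
    then show thesis
    proof cases
      case 1
      then show thesis using disjoint[of x s y r'] xy s r' by blast
    next
      case 2
      then show thesis using disjoint[of x s' y r] xy s' r by blast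
    next
      case 3
      then show thesis using disjoint[of x s r y] xy s r s' r' by blast
    qed
  qed
qed

end

subsection \<open>Classification\<close>

text \<open>The five families without isomorphisms. The parameter \<open>t\<close> does not occur
  because it is the size of a block.\<close>

definition extremal_form :: "('a \<Rightarrow> 'a \<Rightarrow> bool) \<Rightarrow> 'a set \<Rightarrow> 'a set \<Rightarrow> 'a set \<Rightarrow> bool" where
  "extremal_form E A B C \<longleftrightarrow>
     card A = 1 \<and> card C = 1 \<and> (\<exists>a b. B = {a, b} \<and> single_arc E a b) \<and> G2_blocks E A B C \<or>
     complete_on E A \<and> complete_on E B \<and> complete_on E C \<and>
       (card A = 1 \<and> G1_blocks E A B C \<or> (card A = 1 \<or> card C = 1) \<and> G2_blocks E A B C) \<or>
     card A = 1 \<and> card C = 1 \<and> (\<forall>x\<in>B. \<forall>y\<in>B. \<not> E x y) \<and> G2_blocks E A B C"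

lemma tripartition_swap: "tripartition V A B C \<Longrightarrow> tripartition V C B A"
  by (auto simp: tripartition_def)

lemma G2_blocks_reversed: "G2_blocks (\<lambda>x y. E y x) A B C \<longleftrightarrow> G2_blocks E C B A"
  by (auto simp: G2_blocks_def both_ways_def one_way_def)

lemma complete_on_reversed: "complete_on (\<lambda>x y. E y x) A \<longleftrightarrow> complete_on E A"
  by (auto simp: complete_on_def)

lemma (in unseparated_relation) classification:
  assumes "single_arc E x y"
  shows "\<exists>A B C. tripartition V A B C \<and> extremal_form E A B C"
proof (cases "\<exists>x y z. single_arc E x y \<and> single_arc E y z")
  case True
  then obtain z u v where "single_arc E z u" "single_arc E v z" by blast
  from G1_form[OF this] obtain B C where "tripartition V {z} B C" "G1_blocks E {z} B C"
    "complete_on E B" "complete_on E C" by blast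
  moreover have "complete_on E {z}" using E_irrefl by (simp add: complete_on_def)
  ultimately have "tripartition V {z} B C \<and> extremal_form E {z} B C"
    unfolding extremal_form_def by simp
  then show ?thesis by blast
next
  case False
  then interpret split_relation V E by unfold_locales blast
  have single: "complete_on E {z}" for z using E_irrefl by (simp add: complete_on_def)
  from assms show ?thesis
  proof (cases rule: single_arcs_cases)
    case (left r)
    have "tripartition V {r} C S \<and> extremal_form E {r} C S"
      using one_sided_form[OF left] single[of r] unfolding extremal_form_def by auto
    then show ?thesis by blast
  next
    case (right s)
    \<comment> \<open>A single tail is a single head of the reversed relation; reversing back
      exchanges the two outer blocks.\<close>
    have "split_relation.R (\<lambda>x y. E y x) = {s}" using right R_reversed by simp
    note rev = split_relation.one_sided_form[OF split_reversed this, unfolded S_reversed C_reversed]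
    have "tripartition V R C {s}" using rev tripartition_swap by blast
    moreover have "G2_blocks E R C {s}" using rev G2_blocks_reversed[of E "{s}" C R] by blast
    moreover have "complete_on E R" using rev complete_on_reversed[of E R] by blast
    moreover have "complete_on E C \<or> card R = 1 \<and> (\<forall>x\<in>C. \<forall>y\<in>C. \<not> E x y)"
      using rev complete_on_reversed[of E C] by blast
    ultimately have "tripartition V R C {s} \<and> extremal_form E R C {s}"
      using single[of s] unfolding extremal_form_def by auto
    then show ?thesis by blast
  next
    case (disjoint s1 s2 r1 r2)
    have "tripartition V {r1} {s2, r2} {s1} \<and> extremal_form E {r1} {s2, r2} {s1}"
      using P2_form[OF disjoint] unfolding extremal_form_def single_arc_def by auto
    then show ?thesis by blast
  qed
qed

section \<open>The extremal forms have no separated triple and diameter at most 2\<close>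

lemma not_separatedI:
  assumes "\<And>a b c. \<lbrakk>a \<in> V; b \<in> V; c \<in> V; a \<noteq> b; b \<noteq> c; a \<noteq> c\<rbrakk> \<Longrightarrow>
    (\<forall>w\<in>V - {a, b, c}. f w a = f w b) \<or> (\<forall>w\<in>V - {a, b, c}. f w b = f w c) \<or>
    (\<forall>w\<in>V - {a, b, c}. f w a = f w c)"
  shows "\<not> separated_triple V f"
proof
  assume "separated_triple V f"
  then obtain a b c where "a \<in> V" "b \<in> V" "c \<in> V" "a \<noteq> b" "b \<noteq> c" "a \<noteq> c"
    and "\<exists>w\<in>V - {a, b, c}. f w a \<noteq> f w b" "\<exists>w\<in>V - {a, b, c}. f w b \<noteq> f w c"
      "\<exists>w\<in>V - {a, b, c}. f w a \<noteq> f w c"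
    unfolding separated_triple_def by blast
  then show False using assms[of a b c] by fast
qed

text \<open>Only \<open>z\<close> can separate two vertices other than itself. If \<open>z\<close>
  is in the triple, the other two members are unseparated. If not, two members share one of the
  classes \<open>X\<close>, \<open>Y\<close> and look alike from \<open>z\<close>.\<close>

lemma almost_complete_not_separated:
  assumes K: "complete_on E (V - {z})" and V: "V = insert z (X \<union> Y)"
    and X: "\<And>u v. \<lbrakk>u \<in> X; v \<in> X\<rbrakk> \<Longrightarrow> adj_type E z u = adj_type E z v"
    and Y: "\<And>u v. \<lbrakk>u \<in> Y; v \<in> Y\<rbrakk> \<Longrightarrow> adj_type E z u = adj_type E z v"
  shows "\<not> separated_triple V (adj_type E)"
proof (rule not_separatedI)
  fix a b c assume abc: "a \<in> V" "b \<in> V" "c \<in> V" "a \<noteq> b" "b \<noteq> c" "a \<noteq> c"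
  have eq: "adj_type E w u = adj_type E w v"
    if "w \<in> V - {z}" "u \<in> V - {z}" "v \<in> V - {z}" "w \<noteq> u" "w \<noteq> v" for u v w
    using that K by (simp add: complete_on_def adj_type_def)
  let ?e = "\<lambda>u v. \<forall>w\<in>V - {a, b, c}. adj_type E w u = adj_type E w v"
  consider "a = z" | "b = z" | "c = z" | "z \<notin> {a, b, c}" by blast
  then show "?e a b \<or> ?e b c \<or> ?e a c"
  proof cases
    case 1
    have "?e b c" by (intro ballI eq) (use 1 abc in auto)
    then show ?thesis by blast
  next
    case 2
    have "?e a c" by (intro ballI eq) (use 2 abc in auto)
    then show ?thesis by blast
  next
    case 3
    have "?e a b" by (intro ballI eq) (use 3 abc in auto)
    then show ?thesis by blast
  next
    case 4
    then have "a \<in> X \<union> Y" "b \<in> X \<union> Y" "c \<in> X \<union> Y" using abc V by auto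
    then have "adj_type E z a = adj_type E z b \<or> adj_type E z b = adj_type E z c \<or>
        adj_type E z a = adj_type E z c"
      using X Y by blast
    moreover have "?e u v" if "u \<in> {a, b, c}" "v \<in> {a, b, c}" "adj_type E z u = adj_type E z v" for u v
    proof
      fix w assume w: "w \<in> V - {a, b, c}"
      show "adj_type E w u = adj_type E w v"
      proof (cases "w = z")
        case True
        then show ?thesis using that(3) by simp
      next
        case False
        then show ?thesis using eq[of w u v] w that abc 4 by auto
      qed
    qed
    ultimately show ?thesis by blast
  qed
qed

text \<open>A triple contains two vertices of \<open>B\<close>, which nothing separates, or both
  \<open>p\<close> and \<open>q\<close>. In the second case every vertex outside the triple is in
  \<open>B\<close> and does not separate \<open>p\<close> from \<open>q\<close>.\<close>

lemma two_outside_not_separated: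
  assumes V: "V = {p, q} \<union> B"
    and B: "\<And>u v w. \<lbrakk>u \<in> B; v \<in> B; w \<in> V; w \<noteq> u; w \<noteq> v\<rbrakk> \<Longrightarrow> f w u = f w v"
    and pq: "\<And>w. w \<in> B \<Longrightarrow> f w p = f w q"
  shows "\<not> separated_triple V f"
proof (rule not_separatedI)
  fix a b c assume abc: "a \<in> V" "b \<in> V" "c \<in> V" "a \<noteq> b" "b \<noteq> c" "a \<noteq> c"
  let ?e = "\<lambda>u v. \<forall>w\<in>V - {a, b, c}. f w u = f w v"
  have 1: "?e u v" if "u \<in> B" "v \<in> B" "u \<in> {a, b, c}" "v \<in> {a, b, c}" for u v
    using that by (intro ballI B) auto
  have 2: "?e u v" if "u \<in> V - B" "v \<in> V - B" "u \<in> {a, b, c}" "v \<in> {a, b, c}" "u \<noteq> v" for u v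
  proof
    fix w assume "w \<in> V - {a, b, c}"
    moreover have uv: "u = p \<and> v = q \<or> u = q \<and> v = p" using that V by auto
    ultimately have "w \<in> B" using that V by auto
    from pq[OF this] uv show "f w u = f w v" by auto
  qed
  consider "a \<in> B" "b \<in> B" | "b \<in> B" "c \<in> B" | "a \<in> B" "c \<in> B"
    | "a \<notin> B" "b \<notin> B" | "b \<notin> B" "c \<notin> B" | "a \<notin> B" "c \<notin> B"
    by blast
  then show "?e a b \<or> ?e b c \<or> ?e a c"
    by cases (use 1[of a b] 1[of b c] 1[of a c] 2[of a b] 2[of b c] 2[of a c] abc in simp_all)
qed

text \<open>Each of the four vertices lies on exactly one single arc. The only vertex outside a
  triple is therefore mutual with two of its members and does not separate these.\<close>

lemma P2_not_separated:
  assumes "p \<noteq> q" "p \<noteq> a" "p \<noteq> b" "q \<noteq> a" "q \<noteq> b" "a \<noteq> b"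
    and "E q p" "\<not> E p q" "E a b" "\<not> E b a"
    and "E p a" "E a p" "E p b" "E b p" "E q a" "E a q" "E q b" "E b q"
  shows "\<not> separated_triple {p, a, b, q} (adj_type E)"
  using assms unfolding separated_triple_def adj_type_def by auto

lemma (in finite_relation) complete_on_singleton: "complete_on E {z}"
  using E_irrefl by (simp add: complete_on_def)

lemma extremal_form_cases:
  assumes "extremal_form E A B C"
  obtains (P2) p a b q where "A = {p}" "B = {a, b}" "C = {q}" "single_arc E a b" "G2_blocks E A B C"
  | (G1) z where "A = {z}" "complete_on E B" "complete_on E C" "G1_blocks E A B C"
  | (G2_left) z where "A = {z}" "complete_on E B" "complete_on E C" "G2_blocks E A B C"
  | (G2_right) z where "C = {z}" "complete_on E A" "complete_on E B" "G2_blocks E A B C"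
  | (arcless) p q where "A = {p}" "C = {q}" "\<forall>x\<in>B. \<forall>y\<in>B. \<not> E x y" "G2_blocks E A B C"
  using assms unfolding extremal_form_def by (elim disjE conjE exE card_1_singletonE) blast+

lemma (in finite_relation) extremal_form_not_separated:
  assumes T: "tripartition V A B C" and X: "extremal_form E A B C"
  shows "\<not> separated_triple V (adj_type E)"
proof -
  have V: "V = A \<union> B \<union> C" and dj: "A \<inter> B = {}" "B \<inter> C = {}" "A \<inter> C = {}"
    using T by (simp_all add: tripartition_def)
  have join: "complete_on E (X \<union> Y)" if "complete_on E X" "complete_on E Y" "both_ways E X Y" "X \<inter> Y = {}" for X Y
    using that unfolding complete_on_def both_ways_def by blast
  from X show ?thesis
  proof (cases rule: extremal_form_cases)
    case (P2 p a b q)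
    have "V = {p, a, b, q}" using V P2 by blast
    moreover have "\<not> separated_triple {p, a, b, q} (adj_type E)"
      using P2(4,5) dj unfolding P2(1-3) G2_blocks_def both_ways_def one_way_def single_arc_def
      by (intro P2_not_separated) (auto simp: E_irrefl)
    ultimately show ?thesis by simp
  next
    case (G1 z)
    have "V - {z} = B \<union> C" using V dj G1(1) by auto
    then show ?thesis
      using join[of B C] G1 dj V unfolding G1_blocks_def one_way_def
      by (intro almost_complete_not_separated[of E V z B C]) (auto simp: adj_type_def)
  next
    case (G2_left z)
    have "V - {z} = B \<union> C" using V dj G2_left(1) by auto
    then show ?thesis
      using join[of B C] G2_left dj V unfolding G2_blocks_def
      by (intro almost_complete_not_separated[of E V z B C])
        (auto simp: adj_type_def one_way_def both_ways_def)
  next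
    case (G2_right z)
    have "V - {z} = A \<union> B" using V dj G2_right(1) by auto
    then show ?thesis
      using join[of A B] G2_right dj V unfolding G2_blocks_def
      by (intro almost_complete_not_separated[of E V z A B])
        (auto simp: adj_type_def one_way_def both_ways_def)
  next
    case (arcless p q)
    show ?thesis
    proof (rule two_outside_not_separated[of V p q B])
      show "V = {p, q} \<union> B" using V arcless by auto
      show "adj_type E w u = adj_type E w v" if "u \<in> B" "v \<in> B" "w \<in> V" for u v w
        using that arcless V by (auto simp: adj_type_def G2_blocks_def both_ways_def)
      show "adj_type E w p = adj_type E w q" if "w \<in> B" for w
        using that arcless by (auto simp: adj_type_def G2_blocks_def both_ways_def)
    qed
  qed
qed

text \<open>In the \<open>G2\<close> forms the missing arcs lead from \<open>A\<close> to
  \<open>C\<close>, with a detour through \<open>B\<close>, or stay inside \<open>B\<close>, with a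
  detour through an outer block. In the \<open>G1\<close> form they lead from \<open>A\<close> to
  \<open>C\<close>, through \<open>B\<close>, or from \<open>B\<close> to \<open>A\<close>, through
  \<open>C\<close>.\<close>

lemma (in finite_relation) extremal_form_diam_2:
  assumes T: "tripartition V A B C" and X: "extremal_form E A B C"
    and xy: "x \<in> V" "y \<in> V" "x \<noteq> y" "\<not> E x y"
  shows "\<exists>m. E x m \<and> E m y"
proof -
  obtain a b c where abc: "a \<in> A" "b \<in> B" "c \<in> C" using T unfolding tripartition_def by blast
  have V: "V = A \<union> B \<union> C" using T by (simp add: tripartition_def)
  have K: "\<not> (u \<in> X \<and> v \<in> X)" if "complete_on E X" "u \<noteq> v" "\<not> E u v" for u v X
    using that by (auto simp: complete_on_def)
  have G2: ?thesis if "complete_on E A" "complete_on E C" "G2_blocks E A B C"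
  proof -
    have "\<not> (x \<in> A \<and> y \<in> A)" "\<not> (x \<in> C \<and> y \<in> C)" using K that xy by blast+
    moreover have "\<And>u v. u \<in> A \<Longrightarrow> v \<in> B \<Longrightarrow> E u v \<and> E v u"
      "\<And>u v. u \<in> B \<Longrightarrow> v \<in> C \<Longrightarrow> E u v \<and> E v u" "\<And>u v. u \<in> C \<Longrightarrow> v \<in> A \<Longrightarrow> E u v"
      using that(3) by (auto simp: G2_blocks_def both_ways_def one_way_def)
    moreover consider "x \<in> A" | "x \<in> B" | "x \<in> C" using xy V by blast
    ultimately show ?thesis using xy V abc by (metis UnE)
  qed
  from X show ?thesis
  proof (cases rule: extremal_form_cases)
    case (G1 z)
    then have "\<not> (x \<in> A \<and> y \<in> A)" "\<not> (x \<in> B \<and> y \<in> B)" "\<not> (x \<in> C \<and> y \<in> C)" using K xy by blast+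
    moreover have "\<And>u v. u \<in> A \<Longrightarrow> v \<in> B \<Longrightarrow> E u v"
      "\<And>u v. u \<in> B \<Longrightarrow> v \<in> C \<Longrightarrow> E u v \<and> E v u" "\<And>u v. u \<in> C \<Longrightarrow> v \<in> A \<Longrightarrow> E u v"
      using G1(4) by (auto simp: G1_blocks_def both_ways_def one_way_def)
    ultimately show ?thesis using xy V abc by (metis UnE)
  qed (use G2 complete_on_singleton in blast)+
qed

theorem (in finite_relation) unseparated_iff_extremal_form:
  assumes "single_arc E x y"
  shows "(\<forall>x\<in>V. \<forall>y\<in>V. x \<noteq> y \<longrightarrow> E x y \<or> (\<exists>m. E x m \<and> E m y)) \<and> \<not> separated_triple V (adj_type E) \<longleftrightarrow>
    (\<exists>A B C. tripartition V A B C \<and> extremal_form E A B C)" (is "?L \<longleftrightarrow> ?R")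
proof
  assume ?L
  then interpret unseparated_relation V E by unfold_locales blast+
  show ?R by (rule classification[OF assms])
next
  assume ?R
  then show ?L using extremal_form_diam_2 extremal_form_not_separated by blast
qed

section \<open>Distances and the weak metric dimension\<close>

context wf_digraph begin

text \<open>Cutting out cycles never lengthens a walk. Hence \<open>digraph_dist\<close>, a minimum
  over paths, is bounded by walks, which unlike paths can be concatenated freely.\<close>

lemma length_awalk_to_apath: "awalk u p v \<Longrightarrow> length (awalk_to_apath p) \<le> length p"
proof (induct rule: awalk_to_apath_induct)
  case (path p)
  then have "awalk_to_apath p = p" by (auto simp: awalk_to_apath.simps)
  then show ?case by simp
next
  case (decomp p q r s)
  then have "length (q @ s) \<le> length p" by (auto elim!: awalk_cyc_decompE)
  then show ?case using decomp step_awalk_to_apath[of _ p _ q r s] by auto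
qed

lemma digraph_dist_le:
  assumes "awalk u p v" shows "digraph_dist G u v \<le> length p"
proof -
  have "digraph_dist G u v \<le> length (awalk_to_apath p)"
    unfolding digraph_dist_def using apath_awalk_to_apath[OF assms] by (intro Least_le) blast
  then show ?thesis using length_awalk_to_apath[OF assms] by linarith
qed

lemma digraph_dist_awalk:
  assumes "u \<rightarrow>\<^sup>* v" obtains p where "awalk u p v" "length p = digraph_dist G u v"
proof -
  have "\<exists>k p. apath u p v \<and> length p = k" using assms by (auto simp: reachable_apath)
  from LeastI_ex[OF this] show thesis
    using that unfolding digraph_dist_def by (auto intro: awalkI_apath)
qed

lemma digraph_dist_refl: "u \<in> verts G \<Longrightarrow> digraph_dist G u u = 0"
  using digraph_dist_le[of u "[]" u] by (simp add: awalk_Nil_iff)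

lemma digraph_dist_arc_le: "u \<rightarrow>\<^bsub>G\<^esub> v \<Longrightarrow> digraph_dist G u v \<le> 1"
proof -
  assume "u \<rightarrow>\<^bsub>G\<^esub> v"
  then obtain e where "awalk u [e] v" by (auto simp: arcs_ends_conv intro: arc_implies_awalk)
  from digraph_dist_le[OF this] show ?thesis by simp
qed

lemma digraph_dist_triangle:
  assumes "u \<rightarrow>\<^sup>* v" "v \<rightarrow>\<^sup>* w"
  shows "digraph_dist G u w \<le> digraph_dist G u v + digraph_dist G v w"
proof -
  obtain p q where "awalk u p v" "length p = digraph_dist G u v"
    and "awalk v q w" "length q = digraph_dist G v w"
    using digraph_dist_awalk assms by metis
  then show ?thesis using digraph_dist_le[of u "p @ q" w] by auto
qed

lemma digraph_dist_eq_0: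
  assumes "u \<rightarrow>\<^sup>* v" "digraph_dist G u v = 0" shows "u = v"
  using digraph_dist_awalk[OF assms(1)] assms(2) by (metis awalk_Nil_iff length_0_conv)

lemma digraph_dist_eq_1:
  assumes "u \<rightarrow>\<^sup>* v" "digraph_dist G u v = 1" shows "u \<rightarrow>\<^bsub>G\<^esub> v"
proof -
  obtain p where "awalk u p v" "length p = 1" using digraph_dist_awalk[OF assms(1)] assms(2) by metis
  then obtain e where "awalk u [e] v" by (auto simp: length_Suc_conv)
  then show ?thesis by (auto simp: awalk_simps arcs_ends_conv)
qed

text \<open>Cut a shortest walk after \<open>i\<close> arcs. The pieces bound the two distances from
  above, and the triangle inequality turns both bounds into equalities.\<close>

lemma digraph_dist_levels:
  assumes "u \<rightarrow>\<^sup>* v" "i \<le> digraph_dist G u v"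
  obtains x where "u \<rightarrow>\<^sup>* x" "x \<rightarrow>\<^sup>* v" "digraph_dist G u x = i" "digraph_dist G x v = digraph_dist G u v - i"
proof -
  obtain p where p: "awalk u p v" "length p = digraph_dist G u v"
    using digraph_dist_awalk[OF assms(1)] .
  have "awalk u (take i p @ drop i p) v" using p by simp
  then obtain x where x: "awalk u (take i p) x" "awalk x (drop i p) v"
    unfolding awalk_append_iff by blast
  then have r: "u \<rightarrow>\<^sup>* x" "x \<rightarrow>\<^sup>* v" by (auto intro: reachable_awalkI)
  have "digraph_dist G u x \<le> i" "digraph_dist G x v \<le> digraph_dist G u v - i"
    using digraph_dist_le[OF x(1)] digraph_dist_le[OF x(2)] p(2) assms(2) by auto
  moreover have "digraph_dist G u v \<le> digraph_dist G u x + digraph_dist G x v"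
    by (rule digraph_dist_triangle[OF r])
  ultimately show thesis using that[OF r] assms(2) by linarith
qed

end

section \<open>Resolving sets and separated triples\<close>

text \<open>A vertex outside \<open>T\<close> is the only one at distance 0 from itself, so it
  settles every pair that contains it; only pairs inside \<open>T\<close> are left.\<close>

lemma (in digraph) weakly_resolving_Diff:
  assumes "strongly_connected G" "T \<subseteq> verts G"
    and "\<And>u v. \<lbrakk>u \<in> T; v \<in> T; u \<noteq> v\<rbrakk> \<Longrightarrow> \<exists>w\<in>verts G - T. two_way_dist G w u \<noteq> two_way_dist G w v"
  shows "weakly_resolving G (verts G - T)"
proof -
  have self: "two_way_dist G u u \<noteq> two_way_dist G u v" "two_way_dist G v u \<noteq> two_way_dist G v v"
    if "u \<in> verts G" "v \<in> verts G" "u \<noteq> v" for u v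
    using that digraph_dist_eq_0[of u v] digraph_dist_eq_0[of v u] assms(1)
    by (auto simp: two_way_dist_def digraph_dist_refl strongly_connected_def)
  show ?thesis unfolding weakly_resolving_def
  proof (intro conjI ballI impI)
    fix u v assume uv: "u \<in> verts G" "v \<in> verts G" "u \<noteq> v"
    consider "u \<in> T" "v \<in> T" | "u \<in> verts G - T" | "v \<in> verts G - T" using uv by blast
    then show "\<exists>w\<in>verts G - T. two_way_dist G w u \<noteq> two_way_dist G w v"
      using assms(3)[of u v] self[OF uv] uv by cases blast+
  qed auto
qed

text \<open>The pair \<open>a\<close>, \<open>b\<close> separated by \<open>w\<close> gives a
  resolving set of size \<open>n - 2\<close>. A smaller one exists exactly when some triple has a
  resolving complement.\<close>

lemma (in digraph) weak_metric_dim_eq_iff: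
  assumes G: "strongly_connected G" and n: "card (verts G) = n" "4 \<le> n"
    and abw: "a \<in> verts G" "b \<in> verts G" "w \<in> verts G" "a \<noteq> b" "w \<noteq> a" "w \<noteq> b"
      "two_way_dist G w a \<noteq> two_way_dist G w b"
  shows "weak_metric_dim G = n - 2 \<longleftrightarrow> \<not> separated_triple (verts G) (two_way_dist G)"
proof -
  let ?d = "two_way_dist G"
  have upper: "\<exists>W. weakly_resolving G W \<and> card W = n - 2"
  proof (intro exI conjI)
    show "weakly_resolving G (verts G - {a, b})"
      by (rule weakly_resolving_Diff[OF G]) (use abw in \<open>auto intro: bexI[of _ w]\<close>)
    show "card (verts G - {a, b}) = n - 2"
      using abw n by (simp add: card_Diff_subset)
  qed
  show ?thesis
  proof
    assume dim: "weak_metric_dim G = n - 2"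
    show "\<not> separated_triple (verts G) ?d"
    proof
      assume "separated_triple (verts G) ?d"
      then obtain a b c where abc: "{a, b, c} \<subseteq> verts G" "a \<noteq> b" "b \<noteq> c" "a \<noteq> c"
        and sep: "\<exists>w\<in>verts G - {a, b, c}. ?d w a \<noteq> ?d w b"
          "\<exists>w\<in>verts G - {a, b, c}. ?d w b \<noteq> ?d w c" "\<exists>w\<in>verts G - {a, b, c}. ?d w a \<noteq> ?d w c"
        unfolding separated_triple_def by blast
      have "weakly_resolving G (verts G - {a, b, c})"
      proof (rule weakly_resolving_Diff[OF G abc(1)])
        fix u v assume "u \<in> {a, b, c}" "v \<in> {a, b, c}" "u \<noteq> v"
        then consider "{u, v} = {a, b}" | "{u, v} = {b, c}" | "{u, v} = {a, c}" by blast
        then show "\<exists>w\<in>verts G - {a, b, c}. ?d w u \<noteq> ?d w v"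
          by cases (use sep in \<open>metis doubleton_eq_iff\<close>)+
      qed
      moreover have "card (verts G - {a, b, c}) = n - 3"
        using abc n by (subst card_Diff_subset) auto
      ultimately have "weak_metric_dim G \<le> n - 3"
        unfolding weak_metric_dim_def by (intro Least_le) blast
      with dim n show False by linarith
    qed
  next
    assume not: "\<not> separated_triple (verts G) ?d"
    show "weak_metric_dim G = n - 2"
      unfolding weak_metric_dim_def
    proof (rule Least_equality)
      show "\<exists>W. weakly_resolving G W \<and> card W = n - 2" by (rule upper)
    next
      fix k assume "\<exists>W. weakly_resolving G W \<and> card W = k"
      then obtain W where W: "weakly_resolving G W" "card W = k" by blast
      show "n - 2 \<le> k"
      proof (rule ccontr)
        assume "\<not> n - 2 \<le> k"
        moreover have "W \<subseteq> verts G" "finite W" using W by (auto simp: weakly_resolving_def)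
        ultimately have "3 \<le> card (verts G - W)" using n W(2) by (simp add: card_Diff_subset)
        then obtain T where "T \<subseteq> verts G - W" "card T = 3" by (meson obtain_subset_with_card_n)
        then obtain a b c where abc: "{a, b, c} \<subseteq> verts G - W" "a \<noteq> b" "b \<noteq> c" "a \<noteq> c"
          by (auto simp: card_3_iff)
        \<comment> \<open>The three vertices were chosen outside \<open>W\<close>, so every
          separating vertex from \<open>W\<close> lies outside the triple.\<close>
        have "\<exists>w\<in>verts G - {a, b, c}. ?d w u \<noteq> ?d w v"
          if uv: "u \<in> {a, b, c}" "v \<in> {a, b, c}" "u \<noteq> v" for u v
        proof -
          have "u \<in> verts G" "v \<in> verts G" using uv abc(1) by blast+
          then obtain w where "w \<in> W" "?d w u \<noteq> ?d w v"
            using W(1) uv(3) unfolding weakly_resolving_def by blast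
          moreover have "w \<in> verts G - {a, b, c}" using \<open>w \<in> W\<close> \<open>W \<subseteq> verts G\<close> abc(1) by blast
          ultimately show ?thesis by blast
        qed
        from this[of a b] this[of b c] this[of a c] have "separated_triple (verts G) ?d"
          unfolding separated_triple_def using abc by blast
        with not show False ..
      qed
    qed
  qed
qed

text \<open>If no vertex of \<open>x\<close>, \<open>y\<close>, \<open>z\<close> separated the other
  two, then \<open>d x y = d x z = d y z = d y x\<close>. This supplies the pair required by
  \<open>weak_metric_dim_eq_iff\<close>.\<close>

lemma nonsymmetric_separated_pair:
  fixes d :: "'a \<Rightarrow> 'a \<Rightarrow> 'c"
  assumes "x \<in> V" "y \<in> V" "z \<in> V" "x \<noteq> y" "z \<noteq> x" "z \<noteq> y" "d x y \<noteq> d y x"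
  obtains a b w where "a \<in> V" "b \<in> V" "w \<in> V" "a \<noteq> b" "w \<noteq> a" "w \<noteq> b" "(d w a, d a w) \<noteq> (d w b, d b w)"
proof -
  have "(d y x, d x y) \<noteq> (d y z, d z y) \<or> (d z x, d x z) \<noteq> (d z y, d y z) \<or> (d x y, d y x) \<noteq> (d x z, d z x)"
    using assms(7) by auto
  then show thesis using that assms(1-6) by blast
qed

lemma (in digraph) weak_metric_dim_iff_unseparated:
  assumes G: "strongly_connected G" and n: "card (verts G) = n" "4 \<le> n"
    and xy: "single_arc (\<lambda>x y. x \<rightarrow>\<^bsub>G\<^esub> y) x y"
  shows "weak_metric_dim G = n - 2 \<longleftrightarrow>
    (\<forall>x\<in>verts G. \<forall>y\<in>verts G. x \<noteq> y \<longrightarrow> x \<rightarrow>\<^bsub>G\<^esub> y \<or> (\<exists>m. x \<rightarrow>\<^bsub>G\<^esub> m \<and> m \<rightarrow>\<^bsub>G\<^esub> y)) \<and>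
    \<not> separated_triple (verts G) (adj_type (\<lambda>x y. x \<rightarrow>\<^bsub>G\<^esub> y))"
    (is "_ \<longleftrightarrow> ?diam \<and> \<not> ?sep")
proof -
  let ?d = "digraph_dist G"
  have reach: "u \<rightarrow>\<^sup>* v" if "u \<in> verts G" "v \<in> verts G" for u v
    using G that by (auto simp: strongly_connected_def)
  have dist1: "?d u v = 1 \<longleftrightarrow> u \<rightarrow>\<^bsub>G\<^esub> v" if "u \<in> verts G" "v \<in> verts G" "u \<noteq> v" for u v
    using digraph_dist_eq_1[OF reach[OF that(1,2)]] digraph_dist_arc_le[of u v]
      digraph_dist_eq_0[OF reach[OF that(1,2)]] that(3) by linarith
  have V: "x \<in> verts G" "y \<in> verts G" "x \<noteq> y" "x \<rightarrow>\<^bsub>G\<^esub> y" "\<not> y \<rightarrow>\<^bsub>G\<^esub> x"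
    using xy adj_in_verts[of x y] by (auto simp: single_arc_def)
  have "card {x, y} \<le> 2" by (simp add: card_insert_if)
  then have "\<not> verts G \<subseteq> {x, y}" using n card_mono[of "{x, y}" "verts G"] by auto
  then obtain z where z: "z \<in> verts G" "z \<noteq> x" "z \<noteq> y" by auto
  have "?d x y \<noteq> ?d y x" using dist1[of x y] dist1[of y x] V by auto
  then obtain a b w where abw: "a \<in> verts G" "b \<in> verts G" "w \<in> verts G" "a \<noteq> b" "w \<noteq> a" "w \<noteq> b"
    "two_way_dist G w a \<noteq> two_way_dist G w b"
    unfolding two_way_dist_def using nonsymmetric_separated_pair[OF V(1,2) z(1) V(3) z(2,3)] by metis
  note dim = weak_metric_dim_eq_iff[OF G n abw]
  have le2: "?d u v \<le> 2 \<longleftrightarrow> u \<rightarrow>\<^bsub>G\<^esub> v \<or> (\<exists>m. u \<rightarrow>\<^bsub>G\<^esub> m \<and> m \<rightarrow>\<^bsub>G\<^esub> v)"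
    if uv: "u \<in> verts G" "v \<in> verts G" "u \<noteq> v" for u v
  proof
    assume "?d u v \<le> 2"
    moreover have "?d u v \<noteq> 0" using digraph_dist_eq_0[OF reach] uv by blast
    ultimately consider "?d u v = 1" | "?d u v = 2" by linarith
    then show "u \<rightarrow>\<^bsub>G\<^esub> v \<or> (\<exists>m. u \<rightarrow>\<^bsub>G\<^esub> m \<and> m \<rightarrow>\<^bsub>G\<^esub> v)"
    proof cases
      case 1
      then show ?thesis using dist1 uv by blast
    next
      case 2
      then obtain m where "u \<rightarrow>\<^sup>* m" "m \<rightarrow>\<^sup>* v" "?d u m = 1" "?d m v = 2 - 1"
        using digraph_dist_levels[OF reach[OF uv(1,2)], of 1] by auto
      then show ?thesis using digraph_dist_eq_1[of u m] digraph_dist_eq_1[of m v] by auto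
    qed
  next
    assume "u \<rightarrow>\<^bsub>G\<^esub> v \<or> (\<exists>m. u \<rightarrow>\<^bsub>G\<^esub> m \<and> m \<rightarrow>\<^bsub>G\<^esub> v)"
    then show "?d u v \<le> 2"
    proof (elim disjE exE conjE)
      assume "u \<rightarrow>\<^bsub>G\<^esub> v" then show ?thesis using digraph_dist_arc_le[of u v] by linarith
    next
      fix m assume m: "u \<rightarrow>\<^bsub>G\<^esub> m" "m \<rightarrow>\<^bsub>G\<^esub> v"
      then have "u \<rightarrow>\<^sup>* m" "m \<rightarrow>\<^sup>* v" by blast+
      from digraph_dist_triangle[OF this] show ?thesis
        using digraph_dist_arc_le[OF m(1)] digraph_dist_arc_le[OF m(2)] by linarith
    qed
  qed
  have diam: ?diam if not: "\<not> separated_triple (verts G) (two_way_dist G)"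
  proof (intro ballI impI)
    fix u v assume uv: "u \<in> verts G" "v \<in> verts G" "u \<noteq> v"
    show "u \<rightarrow>\<^bsub>G\<^esub> v \<or> (\<exists>m. u \<rightarrow>\<^bsub>G\<^esub> m \<and> m \<rightarrow>\<^bsub>G\<^esub> v)"
    proof (rule ccontr)
      assume "\<not> ?thesis"
      then have "\<not> ?d u v \<le> 2" using le2[OF uv] by blast
      then have ge3: "i \<le> ?d u v" if "i \<le> 3" for i using that by linarith
      have "\<exists>p. p \<in> verts G \<and> ?d u p = i" if "i \<le> 3" for i
        by (rule digraph_dist_levels[OF reach[OF uv(1,2)] ge3[OF that]]) (auto dest: reachable_in_verts)
      \<comment> \<open>The three vertices need not lie on a common geodesic: only their distances
        1, 2, 3 from \<open>u\<close> are used, and \<open>u\<close> separates all three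
        pairs.\<close>
      from this[of 1] this[of 2] this[of 3] obtain p q r
        where pqr: "p \<in> verts G" "?d u p = 1" "q \<in> verts G" "?d u q = 2" "r \<in> verts G" "?d u r = 3"
        by auto
      have "?d u u = 0" using digraph_dist_refl uv by blast
      then have "u \<in> verts G - {p, q, r}" "p \<noteq> q" "q \<noteq> r" "p \<noteq> r" using pqr uv by auto
      moreover have "two_way_dist G u p \<noteq> two_way_dist G u q" "two_way_dist G u q \<noteq> two_way_dist G u r"
        "two_way_dist G u p \<noteq> two_way_dist G u r" using pqr by (auto simp: two_way_dist_def)
      ultimately have "separated_triple (verts G) (two_way_dist G)"
        unfolding separated_triple_def using pqr(1,3,5) by blast
      with not show False ..
    qed
  qed
  have "separated_triple (verts G) (two_way_dist G) \<longleftrightarrow> ?sep" if ?diam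
  proof -
    \<comment> \<open>With all distances at most 2, the distance between distinct vertices records
      just whether the arc is present, so \<open>two_way_dist\<close> and \<open>adj_type\<close>
      separate the same vertices.\<close>
    have "?d u v = (if u \<rightarrow>\<^bsub>G\<^esub> v then 1 else 2)" if "u \<in> verts G" "v \<in> verts G" "u \<noteq> v" for u v
      using le2[OF that] dist1[OF that] digraph_dist_eq_0[OF reach[OF that(1,2)]] \<open>?diam\<close> that
      by (smt (verit, best) One_nat_def le_SucE le_zero_eq numeral_2_eq_2)
    then have eq: "two_way_dist G w u = two_way_dist G w v \<longleftrightarrow>
        adj_type (\<lambda>x y. x \<rightarrow>\<^bsub>G\<^esub> y) w u = adj_type (\<lambda>x y. x \<rightarrow>\<^bsub>G\<^esub> y) w v"
      if "u \<in> verts G" "v \<in> verts G" "w \<in> verts G" "w \<noteq> u" "w \<noteq> v" for u v w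
      using that by (simp add: two_way_dist_def adj_type_def)
    show ?thesis
      by (rule iffI; erule separated_triple_mono) (simp_all add: eq)
  qed
  then show ?thesis using dim diam by blast
qed

section \<open>Isomorphism with a generalized lexicographic product\<close>

text \<open>The arcs of \<open>G\<close> are abstract, those of \<open>with_proj H\<close> are
  pairs. A map on vertices forces the map on arcs, which is injective because \<open>G\<close> has
  no parallel arcs.\<close>

lemma (in digraph) digraph_iso_with_proj_iff:
  assumes H: "parcs H \<subseteq> pverts H \<times> pverts H"
  shows "digraph_iso G (with_proj H) \<longleftrightarrow>
    (\<exists>h. bij_betw h (verts G) (pverts H) \<and>
      (\<forall>x\<in>verts G. \<forall>y\<in>verts G. x \<rightarrow>\<^bsub>G\<^esub> y \<longleftrightarrow> (h x, h y) \<in> parcs H))" (is "_ \<longleftrightarrow> ?R")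
proof
  assume "digraph_iso G (with_proj H)"
  then obtain f where f: "digraph_isomorphism f" and HG: "with_proj H = app_iso f G"
    unfolding digraph_iso_def by blast
  let ?h = "iso_verts f"
  have inj: "inj_on ?h (verts G)" using f by (simp add: digraph_isomorphism_def)
  have V: "pverts H = ?h ` verts G" and A: "parcs H = iso_arcs f ` arcs G"
    and ends: "iso_tail f = fst" "iso_head f = snd"
    using HG by (simp_all add: with_proj_def app_iso_def)
  have "iso_arcs f a = (?h (tail G a), ?h (head G a))" if "a \<in> arcs G" for a
    using f that by (simp add: digraph_isomorphism_def ends)
  then have arcs: "parcs H = (\<lambda>a. (?h (tail G a), ?h (head G a))) ` arcs G"
    unfolding A by (rule image_cong[OF refl])
  have "x \<rightarrow>\<^bsub>G\<^esub> y \<longleftrightarrow> (?h x, ?h y) \<in> parcs H" if "x \<in> verts G" "y \<in> verts G" for x y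
    using that inj unfolding arcs by (auto simp: arcs_ends_conv image_iff inj_on_eq_iff)
  then show ?R using inj V unfolding bij_betw_def by blast
next
  assume ?R
  then obtain h where h: "inj_on h (verts G)" "h ` verts G = pverts H"
    and arcs: "\<And>x y. \<lbrakk>x \<in> verts G; y \<in> verts G\<rbrakk> \<Longrightarrow> x \<rightarrow>\<^bsub>G\<^esub> y \<longleftrightarrow> (h x, h y) \<in> parcs H"
    unfolding bij_betw_def by blast
  let ?f = "\<lparr>iso_verts = h, iso_arcs = (\<lambda>a. (h (tail G a), h (head G a))), iso_head = snd, iso_tail = fst\<rparr>"
  have "inj_on (\<lambda>a. (h (tail G a), h (head G a))) (arcs G)"
  proof (rule inj_onI)
    fix a b assume "a \<in> arcs G" "b \<in> arcs G" "(h (tail G a), h (head G a)) = (h (tail G b), h (head G b))"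
    then show "a = b" using h(1) by (intro no_multi_arcs) (auto simp: arc_to_ends_def inj_on_eq_iff)
  qed
  then have "digraph_isomorphism ?f"
    using h(1) wf_digraph by (simp add: digraph_isomorphism_def)
  moreover have "(\<lambda>a. (h (tail G a), h (head G a))) ` arcs G = parcs H"
  proof (intro equalityI subsetI)
    fix e assume "e \<in> (\<lambda>a. (h (tail G a), h (head G a))) ` arcs G"
    then obtain a where "a \<in> arcs G" "e = (h (tail G a), h (head G a))" by blast
    then show "e \<in> parcs H"
      using arcs[of "tail G a" "head G a"] by (auto simp: arcs_ends_conv)
  next
    fix e assume e: "e \<in> parcs H"
    then obtain x y where xy: "e = (h x, h y)" "x \<in> verts G" "y \<in> verts G"
      using H unfolding h(2)[symmetric] by blast
    then have "x \<rightarrow>\<^bsub>G\<^esub> y" using arcs e by simp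
    then show "e \<in> (\<lambda>a. (h (tail G a), h (head G a))) ` arcs G"
      using xy(1) by (auto simp: arcs_ends_conv)
  qed
  ultimately show "digraph_iso G (with_proj H)"
    unfolding digraph_iso_def using h(2) by (intro exI[of _ ?f]) (simp add: app_iso_def with_proj_def)
qed

section \<open>Isomorphism of single blocks\<close>

definition rel_iso :: "('a \<Rightarrow> 'a \<Rightarrow> bool) \<Rightarrow> 'a set \<Rightarrow> 'b pair_pre_digraph \<Rightarrow> bool" where
  "rel_iso E A H \<longleftrightarrow> (\<exists>g. bij_betw g A (pverts H) \<and> (\<forall>x\<in>A. \<forall>y\<in>A. E x y \<longleftrightarrow> (g x, g y) \<in> parcs H))"

lemma rel_iso_K_digraph:
  "rel_iso E A (K_digraph t) \<longleftrightarrow> finite A \<and> card A = t \<and> complete_on E A"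
proof
  assume "rel_iso E A (K_digraph t)"
  then obtain g where g: "bij_betw g A {..<t}" "\<forall>x\<in>A. \<forall>y\<in>A. E x y \<longleftrightarrow> (g x, g y) \<in> parcs (K_digraph t)"
    by (auto simp: rel_iso_def K_digraph_def)
  moreover have "(g x, g y) \<in> parcs (K_digraph t) \<longleftrightarrow> x \<noteq> y" if "x \<in> A" "y \<in> A" for x y
    using that g(1) by (auto simp: K_digraph_def bij_betw_def inj_on_eq_iff)
  ultimately show "finite A \<and> card A = t \<and> complete_on E A"
    using bij_betw_same_card[OF g(1)] bij_betw_finite[OF g(1)] by (simp add: complete_on_def)
next
  assume A: "finite A \<and> card A = t \<and> complete_on E A"
  then obtain g where g: "bij_betw g A {..<t}"
    using finite_same_card_bij[of A "{..<t}"] by auto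
  moreover have "(g x, g y) \<in> parcs (K_digraph t) \<longleftrightarrow> x \<noteq> y" if "x \<in> A" "y \<in> A" for x y
    using that g by (auto simp: K_digraph_def bij_betw_def inj_on_eq_iff)
  ultimately show "rel_iso E A (K_digraph t)"
    using A by (auto simp: rel_iso_def complete_on_def K_digraph_def)
qed

lemma rel_iso_arcless_digraph:
  "rel_iso E A (arcless_digraph t) \<longleftrightarrow> finite A \<and> card A = t \<and> (\<forall>x\<in>A. \<forall>y\<in>A. \<not> E x y)"
  using finite_same_card_bij[of A "{..<t}"] bij_betw_same_card[of _ A "{..<t}"]
    bij_betw_finite[of _ A "{..<t}"]
  by (auto simp: rel_iso_def arcless_digraph_def)

text \<open>Irreflexivity is what makes \<open>a\<close> and \<open>b\<close> distinct when the
  bijection is built from the single arc.\<close>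

lemma rel_iso_P2_digraph:
  assumes "\<And>x. \<not> E x x"
  shows "rel_iso E A P2_digraph \<longleftrightarrow> (\<exists>a b. A = {a, b} \<and> single_arc E a b)"
proof
  assume "rel_iso E A P2_digraph"
  then obtain g where "bij_betw g A (pverts P2_digraph)"
    "\<forall>x\<in>A. \<forall>y\<in>A. E x y \<longleftrightarrow> (g x, g y) \<in> parcs P2_digraph"
    unfolding rel_iso_def by blast
  then have g: "bij_betw g A {0, 1}"
    and E: "\<And>x y. \<lbrakk>x \<in> A; y \<in> A\<rbrakk> \<Longrightarrow> E x y \<longleftrightarrow> g x = 0 \<and> g y = 1"
    by (simp_all add: P2_digraph_def)
  from g obtain a b where ab: "a \<in> A" "b \<in> A" "g a = 0" "g b = 1"
    by (metis bij_betw_imp_surj_on imageE insertI1 insertI2)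
  moreover have "A \<subseteq> {a, b}"
  proof
    fix x assume "x \<in> A"
    then have "g x = g a \<or> g x = g b" using g ab by (auto simp: bij_betw_def)
    then have "x = a \<or> x = b"
      using \<open>x \<in> A\<close> ab(1,2) inj_onD[OF bij_betw_imp_inj_on[OF g]] by blast
    then show "x \<in> {a, b}" by simp
  qed
  ultimately have "A = {a, b} \<and> single_arc E a b" using E by (auto simp: single_arc_def)
  then show "\<exists>a b. A = {a, b} \<and> single_arc E a b" by blast
next
  assume "\<exists>a b. A = {a, b} \<and> single_arc E a b"
  then obtain a b where ab: "A = {a, b}" "E a b" "\<not> E b a" "a \<noteq> b"
    using assms by (auto simp: single_arc_def)
  define g where "g x = (if x = a then 0 else 1 :: nat)" for x
  have "bij_betw g A {0, 1}" using ab by (auto simp: g_def bij_betw_def inj_on_def)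
  moreover have "\<forall>x\<in>A. \<forall>y\<in>A. E x y \<longleftrightarrow> (g x, g y) \<in> parcs P2_digraph"
    using ab assms by (auto simp: g_def P2_digraph_def)
  ultimately show "rel_iso E A P2_digraph"
    unfolding rel_iso_def by (intro exI[of _ g]) (simp add: P2_digraph_def)
qed

text \<open>All six ordered pairs of distinct indices are prescribed; \<open>G1_blocks\<close> and
  \<open>G2_blocks\<close> are the two instances in use.\<close>

definition quotient_blocks :: "nat pair_pre_digraph \<Rightarrow> ('a \<Rightarrow> 'a \<Rightarrow> bool) \<Rightarrow> 'a set \<Rightarrow> 'a set \<Rightarrow> 'a set \<Rightarrow> bool" where
  "quotient_blocks Q E A B C \<longleftrightarrow>
     (\<forall>x\<in>A. \<forall>y\<in>B. (E x y \<longleftrightarrow> (0, 1) \<in> parcs Q) \<and> (E y x \<longleftrightarrow> (1, 0) \<in> parcs Q)) \<and>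
     (\<forall>x\<in>B. \<forall>y\<in>C. (E x y \<longleftrightarrow> (1, 2) \<in> parcs Q) \<and> (E y x \<longleftrightarrow> (2, 1) \<in> parcs Q)) \<and>
     (\<forall>x\<in>C. \<forall>y\<in>A. (E x y \<longleftrightarrow> (2, 0) \<in> parcs Q) \<and> (E y x \<longleftrightarrow> (0, 2) \<in> parcs Q))"

lemma quotient_blocks_G1: "quotient_blocks G1_digraph E A B C \<longleftrightarrow> G1_blocks E A B C"
  by (simp add: quotient_blocks_def G1_digraph_def G1_blocks_def one_way_def both_ways_def)

lemma quotient_blocks_G2: "quotient_blocks G2_digraph E A B C \<longleftrightarrow> G2_blocks E A B C"
  by (simp add: quotient_blocks_def G2_digraph_def G2_blocks_def one_way_def both_ways_def)

section \<open>Products with three factors\<close>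

lemma pverts_gen_lex_prod3:
  "pverts (gen_lex_prod Q [H0, H1, H2]) = Pair 0 ` pverts H0 \<union> Pair 1 ` pverts H1 \<union> Pair 2 ` pverts H2"
  by (auto simp: gen_lex_prod_def less_Suc_eq numeral_2_eq_2)

lemma parcs_gen_lex_prod3:
  "((i, x), (j, y)) \<in> parcs (gen_lex_prod Q [H0, H1, H2]) \<longleftrightarrow>
    (i, x) \<in> pverts (gen_lex_prod Q [H0, H1, H2]) \<and> (j, y) \<in> pverts (gen_lex_prod Q [H0, H1, H2]) \<and>
    (if i = j then (x, y) \<in> parcs ([H0, H1, H2] ! i) else (i, j) \<in> parcs Q)"
  by (auto simp: gen_lex_prod_def)

text \<open>The blocks are the fibres of the tag under an isomorphism; conversely, isomorphisms of
  the blocks are glued by adding the tags. Blocks may be empty here.\<close>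

lemma (in digraph) digraph_iso_gen_lex_prod3:
  "digraph_iso G (with_proj (gen_lex_prod Q [H0, H1, H2])) \<longleftrightarrow>
    (\<exists>A B C. verts G = A \<union> B \<union> C \<and> A \<inter> B = {} \<and> B \<inter> C = {} \<and> A \<inter> C = {} \<and>
      rel_iso (dominates G) A H0 \<and> rel_iso (dominates G) B H1 \<and> rel_iso (dominates G) C H2 \<and>
      quotient_blocks Q (dominates G) A B C)" (is "?L \<longleftrightarrow> ?R")
proof -
  let ?P = "gen_lex_prod Q [H0, H1, H2]"
  have P: "parcs ?P \<subseteq> pverts ?P \<times> pverts ?P"
    by (auto simp: gen_lex_prod_def)
  show ?thesis
  proof
    assume ?L
    then obtain h where h: "bij_betw h (verts G) (pverts ?P)"
      and arcs: "\<And>x y. \<lbrakk>x \<in> verts G; y \<in> verts G\<rbrakk> \<Longrightarrow> x \<rightarrow>\<^bsub>G\<^esub> y \<longleftrightarrow> (h x, h y) \<in> parcs ?P"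
      using digraph_iso_with_proj_iff[OF P] by auto
    have hV: "h x \<in> pverts ?P" if "x \<in> verts G" for x using h that by (auto simp: bij_betw_def)
    have arcs': "x \<rightarrow>\<^bsub>G\<^esub> y \<longleftrightarrow> (if fst (h x) = fst (h y)
        then (snd (h x), snd (h y)) \<in> parcs ([H0, H1, H2] ! fst (h x)) else (fst (h x), fst (h y)) \<in> parcs Q)"
      if "x \<in> verts G" "y \<in> verts G" for x y
      using arcs[OF that] hV[OF that(1)] hV[OF that(2)]
        parcs_gen_lex_prod3[of "fst (h x)" "snd (h x)" "fst (h y)" "snd (h y)" Q H0 H1 H2] by simp
    define X where "X i = {x \<in> verts G. fst (h x) = i}" for i
    have iso: "rel_iso (dominates G) (X i) ([H0, H1, H2] ! i)" if "i < 3" for i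
    proof -
      have "snd ` h ` X i = pverts ([H0, H1, H2] ! i)"
      proof -
        have "h ` X i = {p \<in> h ` verts G. fst p = i}" by (auto simp: X_def)
        also have "\<dots> = {p \<in> pverts ?P. fst p = i}" using h by (simp add: bij_betw_def)
        also have "\<dots> = Pair i ` pverts ([H0, H1, H2] ! i)"
          using that by (auto simp: gen_lex_prod_def)
        finally show ?thesis by (simp add: image_image)
      qed
      moreover have "inj_on (snd \<circ> h) (X i)"
        using h by (auto simp: X_def bij_betw_def inj_on_def prod_eq_iff)
      ultimately have "bij_betw (snd \<circ> h) (X i) (pverts ([H0, H1, H2] ! i))"
        by (simp add: bij_betw_def image_comp)
      then show ?thesis unfolding rel_iso_def
        by (intro exI[of _ "snd \<circ> h"]) (auto simp: X_def arcs')
    qed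
    have "fst (h x) \<in> {0, 1, 2}" if "x \<in> verts G" for x
      using hV[OF that] by (auto simp: pverts_gen_lex_prod3)
    then have "verts G = X 0 \<union> X 1 \<union> X 2" by (auto simp: X_def)
    moreover have "X 0 \<inter> X 1 = {}" "X 1 \<inter> X 2 = {}" "X 0 \<inter> X 2 = {}" by (auto simp: X_def)
    moreover have "rel_iso (dominates G) (X 0) H0" "rel_iso (dominates G) (X 1) H1" "rel_iso (dominates G) (X 2) H2"
      using iso[of 0] iso[of 1] iso[of 2] by auto
    moreover have "quotient_blocks Q (dominates G) (X 0) (X 1) (X 2)"
      by (auto simp: quotient_blocks_def X_def arcs')
    ultimately show ?R by blast
  next
    assume ?R
    then obtain A B C where V: "verts G = A \<union> B \<union> C" and dj: "A \<inter> B = {}" "B \<inter> C = {}" "A \<inter> C = {}"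
      and iso: "rel_iso (dominates G) A H0" "rel_iso (dominates G) B H1" "rel_iso (dominates G) C H2"
      and Q: "quotient_blocks Q (dominates G) A B C" by blast
    obtain f0 f1 f2 where f: "bij_betw f0 A (pverts H0)" "bij_betw f1 B (pverts H1)" "bij_betw f2 C (pverts H2)"
      and E0: "\<And>x y. \<lbrakk>x \<in> A; y \<in> A\<rbrakk> \<Longrightarrow> x \<rightarrow>\<^bsub>G\<^esub> y \<longleftrightarrow> (f0 x, f0 y) \<in> parcs H0"
      and E1: "\<And>x y. \<lbrakk>x \<in> B; y \<in> B\<rbrakk> \<Longrightarrow> x \<rightarrow>\<^bsub>G\<^esub> y \<longleftrightarrow> (f1 x, f1 y) \<in> parcs H1"
      and E2: "\<And>x y. \<lbrakk>x \<in> C; y \<in> C\<rbrakk> \<Longrightarrow> x \<rightarrow>\<^bsub>G\<^esub> y \<longleftrightarrow> (f2 x, f2 y) \<in> parcs H2"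
      using iso unfolding rel_iso_def by blast
    define h where "h x = (if x \<in> A then (0 :: nat, f0 x) else if x \<in> B then (1, f1 x) else (2, f2 x))" for x
    have hA: "h x = (0, f0 x)" if "x \<in> A" for x using that by (simp add: h_def)
    have hB: "h x = (1, f1 x)" if "x \<in> B" for x using that dj by (auto simp: h_def)
    have hC: "h x = (2, f2 x)" if "x \<in> C" for x using that dj by (auto simp: h_def)
    have img: "f0 ` A = pverts H0" "f1 ` B = pverts H1" "f2 ` C = pverts H2"
      using f by (auto simp: bij_betw_def)
    have "h ` A = Pair 0 ` f0 ` A" "h ` B = Pair 1 ` f1 ` B" "h ` C = Pair 2 ` f2 ` C"
      unfolding image_image using hA hB hC by (auto intro!: image_cong)
    then have hV: "h ` verts G = pverts ?P" unfolding V image_Un pverts_gen_lex_prod3 img by simp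
    moreover have "inj_on h (verts G)"
    proof (rule inj_onI)
      fix x y assume "x \<in> verts G" "y \<in> verts G" "h x = h y"
      then show "x = y"
        unfolding V using f by (elim UnE) (auto simp: hA hB hC bij_betw_def inj_on_eq_iff)
    qed
    moreover have "x \<rightarrow>\<^bsub>G\<^esub> y \<longleftrightarrow> (h x, h y) \<in> parcs ?P" if xy: "x \<in> verts G" "y \<in> verts G" for x y
    proof -
      have "h x \<in> pverts ?P" "h y \<in> pverts ?P" using hV xy by auto
      then have *: "(h x, h y) \<in> parcs ?P \<longleftrightarrow> (if fst (h x) = fst (h y)
          then (snd (h x), snd (h y)) \<in> parcs ([H0, H1, H2] ! fst (h x)) else (fst (h x), fst (h y)) \<in> parcs Q)"
        using parcs_gen_lex_prod3[of "fst (h x)" "snd (h x)" "fst (h y)" "snd (h y)" Q H0 H1 H2] by simp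
      show ?thesis
        using xy Q unfolding * V quotient_blocks_def
        by (elim UnE) (simp_all add: hA hB hC E0 E1 E2)
    qed
    ultimately show ?L
      unfolding digraph_iso_with_proj_iff[OF P] bij_betw_def by blast
  qed
qed

text \<open>The parameter \<open>t\<close> is the size of \<open>B\<close>, or of \<open>A\<close>
  in the last complete family. The bounds on \<open>t\<close> say that the two blocks of sizes
  \<open>t\<close> and \<open>n - t - 1\<close> are nonempty.\<close>

lemma (in digraph) extremal_form_iff_iso:
  assumes n: "card (verts G) = n" "4 \<le> n"
  shows "(\<exists>A B C. tripartition (verts G) A B C \<and> extremal_form (dominates G) A B C) \<longleftrightarrow>
    (digraph_iso G (with_proj (gen_lex_prod G2_digraph [K_digraph 1, P2_digraph, K_digraph 1])) \<or>
     (\<exists>t. 1 \<le> t \<and> t \<le> n - 2 \<and>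
       (digraph_iso G (with_proj (gen_lex_prod G1_digraph [K_digraph 1, K_digraph t, K_digraph (n - t - 1)])) \<or>
        digraph_iso G (with_proj (gen_lex_prod G2_digraph [K_digraph 1, K_digraph t, K_digraph (n - t - 1)])) \<or>
        digraph_iso G (with_proj (gen_lex_prod G2_digraph [K_digraph t, K_digraph (n - t - 1), K_digraph 1])))) \<or>
     digraph_iso G (with_proj (gen_lex_prod G2_digraph [K_digraph 1, arcless_digraph (n - 2), K_digraph 1])))"
    (is "?L \<longleftrightarrow> ?R")
proof -
  let ?E = "dominates G"
  let ?part = "\<lambda>A B C. verts G = A \<union> B \<union> C \<and> A \<inter> B = {} \<and> B \<inter> C = {} \<and> A \<inter> C = {}"
  have irrefl: "\<not> ?E x x" for x using adj_not_same by blast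
  have fin: "finite A \<and> finite B \<and> finite C" if "?part A B C" for A B C
    using finite_verts that by (metis finite_Un)
  have card_part: "card A + card B + card C = n" if "?part A B C" for A B C
    using fin[OF that] that n(1) by (metis card_Un_disjoint Int_Un_distrib2 Un_empty finite_UnI)
  have KKK: "digraph_iso G (with_proj (gen_lex_prod Q [K_digraph a, K_digraph b, K_digraph c])) \<longleftrightarrow>
      (\<exists>A B C. ?part A B C \<and> (finite A \<and> card A = a \<and> complete_on ?E A) \<and>
        (finite B \<and> card B = b \<and> complete_on ?E B) \<and> (finite C \<and> card C = c \<and> complete_on ?E C) \<and> quotient_blocks Q ?E A B C)" for Q a b c
    by (simp only: digraph_iso_gen_lex_prod3 rel_iso_K_digraph conj_assoc)
  have KPK: "digraph_iso G (with_proj (gen_lex_prod G2_digraph [K_digraph 1, P2_digraph, K_digraph 1])) \<longleftrightarrow>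
      (\<exists>A B C. ?part A B C \<and> (finite A \<and> card A = 1 \<and> complete_on ?E A) \<and> (\<exists>a b. B = {a, b} \<and> single_arc ?E a b) \<and>
        (finite C \<and> card C = 1 \<and> complete_on ?E C) \<and> G2_blocks ?E A B C)"
    by (simp only: digraph_iso_gen_lex_prod3 rel_iso_K_digraph rel_iso_P2_digraph[of ?E, OF irrefl]
      quotient_blocks_G2 conj_assoc)
  have KNK: "digraph_iso G (with_proj (gen_lex_prod G2_digraph [K_digraph 1, arcless_digraph (n - 2), K_digraph 1])) \<longleftrightarrow>
      (\<exists>A B C. ?part A B C \<and> (finite A \<and> card A = 1 \<and> complete_on ?E A) \<and>
        (finite B \<and> card B = n - 2 \<and> (\<forall>x\<in>B. \<forall>y\<in>B. \<not> ?E x y)) \<and>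
        (finite C \<and> card C = 1 \<and> complete_on ?E C) \<and> G2_blocks ?E A B C)"
    by (simp only: digraph_iso_gen_lex_prod3 rel_iso_K_digraph rel_iso_arcless_digraph
      quotient_blocks_G2 conj_assoc)
  have single: "complete_on ?E {z}" for z using irrefl by (simp add: complete_on_def)
  show ?thesis
  proof
    assume ?L
    then obtain A B C where T: "tripartition (verts G) A B C" and X: "extremal_form ?E A B C" by blast
    then have part: "?part A B C" and ne: "A \<noteq> {}" "B \<noteq> {}" "C \<noteq> {}" by (simp_all add: tripartition_def)
    have pos: "1 \<le> card A" "1 \<le> card B" "1 \<le> card C"
      using ne fin[OF part] by (simp_all add: Suc_le_eq card_gt_0_iff)
    note cp = card_part[OF part] and fin = fin[OF part]
    from X show ?R
    proof (cases rule: extremal_form_cases)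
      case (P2 p a b q)
      then have "card A = 1" "card C = 1" "complete_on ?E A" "complete_on ?E C" using single by auto
      moreover have "\<exists>a b. B = {a, b} \<and> single_arc ?E a b" using P2(2,4) by blast
      ultimately have "digraph_iso G (with_proj (gen_lex_prod G2_digraph
          [K_digraph 1, P2_digraph, K_digraph 1]))"
        unfolding KPK using part fin P2(5)
        by - (rule exI[of _ A], rule exI[of _ B], rule exI[of _ C], simp)
      then show ?thesis ..
    next
      case (G1 z)
      then have "n - card B - 1 = card C" "card A = 1" "complete_on ?E A" using cp single by auto
      then have "digraph_iso G (with_proj (gen_lex_prod G1_digraph
          [K_digraph 1, K_digraph (card B), K_digraph (n - card B - 1)]))"
        unfolding KKK quotient_blocks_G1 using part fin G1(2-4)
        by - (rule exI[of _ A], rule exI[of _ B], rule exI[of _ C], simp)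
      moreover have "card B \<le> n - 2" using cp pos by linarith
      ultimately show ?thesis using pos by blast
    next
      case (G2_left z)
      then have "n - card B - 1 = card C" "card A = 1" "complete_on ?E A" using cp single by auto
      then have "digraph_iso G (with_proj (gen_lex_prod G2_digraph
          [K_digraph 1, K_digraph (card B), K_digraph (n - card B - 1)]))"
        unfolding KKK quotient_blocks_G2 using part fin G2_left(2-4)
        by - (rule exI[of _ A], rule exI[of _ B], rule exI[of _ C], simp)
      moreover have "card B \<le> n - 2" using cp pos by linarith
      ultimately show ?thesis using pos by blast
    next
      case (G2_right z)
      then have "n - card A - 1 = card B" "card C = 1" "complete_on ?E C" using cp single by auto
      then have "digraph_iso G (with_proj (gen_lex_prod G2_digraph
          [K_digraph (card A), K_digraph (n - card A - 1), K_digraph 1]))"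
        unfolding KKK quotient_blocks_G2 using part fin G2_right(2-4)
        by - (rule exI[of _ A], rule exI[of _ B], rule exI[of _ C], simp)
      moreover have "card A \<le> n - 2" using cp pos by linarith
      ultimately show ?thesis using pos by blast
    next
      case (arcless p q)
      then have "card A = 1" "card C = 1" "complete_on ?E A" "complete_on ?E C" "card B = n - 2"
        using cp single by auto
      then have "digraph_iso G (with_proj (gen_lex_prod G2_digraph
          [K_digraph 1, arcless_digraph (n - 2), K_digraph 1]))"
        unfolding KNK using part fin arcless(3,4)
        by - (rule exI[of _ A], rule exI[of _ B], rule exI[of _ C], simp)
      then show ?thesis by blast
    qed
  next
    assume ?R
    \<comment> \<open>Unlike the description of products, \<open>tripartition\<close> demands
      nonempty blocks; this is read off from the cardinalities.\<close>
    have L: ?L if "verts G = A \<union> B \<union> C" "A \<inter> B = {}" "B \<inter> C = {}" "A \<inter> C = {}"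
      "1 \<le> card A" "1 \<le> card B" "1 \<le> card C" "extremal_form ?E A B C" for A B C
    proof -
      have "A \<noteq> {}" "B \<noteq> {}" "C \<noteq> {}" using that(5-7) by auto
      then have "tripartition (verts G) A B C" using that(1-4) by (simp add: tripartition_def)
      then show ?thesis using that(8) by blast
    qed
    from \<open>?R\<close> consider
      (P2) "digraph_iso G (with_proj (gen_lex_prod G2_digraph [K_digraph 1, P2_digraph, K_digraph 1]))"
    | (G1) t where "1 \<le> t" "t \<le> n - 2"
        "digraph_iso G (with_proj (gen_lex_prod G1_digraph [K_digraph 1, K_digraph t, K_digraph (n - t - 1)]))"
    | (G2_left) t where "1 \<le> t" "t \<le> n - 2"
        "digraph_iso G (with_proj (gen_lex_prod G2_digraph [K_digraph 1, K_digraph t, K_digraph (n - t - 1)]))"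
    | (G2_right) t where "1 \<le> t" "t \<le> n - 2"
        "digraph_iso G (with_proj (gen_lex_prod G2_digraph [K_digraph t, K_digraph (n - t - 1), K_digraph 1]))"
    | (arcless) "digraph_iso G (with_proj (gen_lex_prod G2_digraph [K_digraph 1, arcless_digraph (n - 2), K_digraph 1]))"
      by blast
    then show ?L
    proof cases
      case P2
      then show ?thesis unfolding KPK
        by - (elim exE conjE, erule L, simp_all add: extremal_form_def card_insert_if, blast)
    next
      case (G1 t)
      \<comment> \<open>The bound \<open>t \<le> n - 2\<close> together with
        \<open>4 \<le> n\<close> keeps the truncated difference positive, so the third block is
        nonempty.\<close>
      have "1 \<le> n - t - 1" using G1(1,2) n(2) by linarith
      with G1 show ?thesis unfolding KKK quotient_blocks_G1
        by - (elim exE conjE, erule L, simp_all add: extremal_form_def)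
    next
      case (G2_left t)
      have "1 \<le> n - t - 1" using G2_left(1,2) n(2) by linarith
      with G2_left show ?thesis unfolding KKK quotient_blocks_G2
        by - (elim exE conjE, erule L, simp_all add: extremal_form_def)
    next
      case (G2_right t)
      have "1 \<le> n - t - 1" using G2_right(1,2) n(2) by linarith
      with G2_right show ?thesis unfolding KKK quotient_blocks_G2
        by - (elim exE conjE, erule L, simp_all add: extremal_form_def)
    next
      case arcless
      have "1 \<le> n - 2" using n(2) by linarith
      with arcless show ?thesis unfolding KNK
        by - (elim exE conjE, erule L, simp_all add: extremal_form_def)
    qed
  qed
qed

theorem theorem4p2:
  fixes \<Gamma> :: "('a, 'b) pre_digraph" and n :: nat
  assumes "digraph \<Gamma>"
    and "strongly_connected \<Gamma>"
    and "card (verts \<Gamma>) = n"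
    and "n \<ge> 4"
    and "\<not> symmetric \<Gamma>"
  shows "weak_metric_dim \<Gamma> = n - 2 \<longleftrightarrow>
    (digraph_iso \<Gamma> (with_proj (gen_lex_prod G2_digraph [K_digraph 1, P2_digraph, K_digraph 1])) \<or>
     (\<exists>t. 1 \<le> t \<and> t \<le> n - 2 \<and>
       (digraph_iso \<Gamma> (with_proj (gen_lex_prod G1_digraph [K_digraph 1, K_digraph t, K_digraph (n - t - 1)])) \<or>
        digraph_iso \<Gamma> (with_proj (gen_lex_prod G2_digraph [K_digraph 1, K_digraph t, K_digraph (n - t - 1)])) \<or>
        digraph_iso \<Gamma> (with_proj (gen_lex_prod G2_digraph [K_digraph t, K_digraph (n - t - 1), K_digraph 1])))) \<or>
     digraph_iso \<Gamma> (with_proj (gen_lex_prod G2_digraph [K_digraph 1, arcless_digraph (n - 2), K_digraph 1])))"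
proof -
  interpret digraph \<Gamma> by fact
  interpret finite_relation "verts \<Gamma>" "dominates \<Gamma>"
  proof
    show "x \<in> verts \<Gamma> \<and> y \<in> verts \<Gamma>" if "x \<rightarrow>\<^bsub>\<Gamma>\<^esub> y" for x y
      using adj_in_verts[OF that] by blast
    show "\<not> x \<rightarrow>\<^bsub>\<Gamma>\<^esub> x" for x using adj_not_same by blast
  qed (use assms in auto)
  \<comment> \<open>This arc enters twice: it provides the separated pair that bounds the dimension
    by \<open>n - 2\<close>, and it starts the classification.\<close>
  obtain x y where xy: "single_arc (dominates \<Gamma>) x y"
    using assms(5) by (auto simp: symmetric_def sym_def single_arc_def)
  show ?thesis
    unfolding weak_metric_dim_iff_unseparated[OF assms(2-4) xy] unseparated_iff_extremal_form[OF xy]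
    by (rule extremal_form_iff_iso[OF assms(3,4)])
qed

end
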